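(* Let $N\geq 1$, and let $f\in [L^1_{loc}(\mathbb R^N)]^N$ satisfy $\mathrm{div}\, f=0$ in the sense of distributions. Let $\mu,\lambda\in\mathbb R$ be constants with either $\mu=\lambda=0$ or $\mu>0$. Suppose $(\rho, v, S)$ is a stationary weak solution (as defined in the context) of the compressible Navier–Stokes (Euler if $\mu=\lambda=0$) equations on $\mathbb R^N$ with external force $f$, and write $p(x)=p(\rho(x),S(x))$. Assume that the following condition, depending on $\mu$ and $\lambda$, holds: (i) in the inviscid case $\mu=\lambda=0$: $$\int_{\mathbb R^N} \frac{\rho |v|^2 +p}{1+|x|}\, dx<\infty ;$$ (ii) in the viscous case $\mu>0$: (a) if $2\mu+\lambda=0$: $$\int_{\mathbb R^N} (\rho |v|^2 +p)\,dx<\infty ;$$ (b) if $2\mu+\lambda\neq 0$ (and $N\ge 2$, so that the exponent below is defined): $$\int_{\mathbb R^N} \left(\rho |v|^2+|v|^{\frac{N}{N-1}}+p\right)dx<\infty .$$ Then $\rho(x)=0$ for almost every $x\in \mathbb R^N$.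
   Context: The pressure law is a given measurable function $p=p(\rho,S)$ of density $\rho\ge 0$ and entropy $S\in\mathbb R$, with $p(\rho,S)\geq 0$, and $p(\rho,S)=0$ only if $\rho=0$. No other property of $p$ and no entropy equation is assumed. Stationary weak solution: a triple with $v\in [L^2_{loc}(\mathbb R^N)]^N$ (velocity), $\rho\in L^\infty_{loc}(\mathbb R^N)$, $\rho\ge 0$ a.e. (density), and $S\in L^\infty_{loc}(\mathbb R^N)$ (specific entropy), with $p=p(\rho,S)$ locally integrable, is called a stationary weak solution of the compressible Navier–Stokes (Euler for $\mu=\lambda=0$) equations with constants $\mu,\lambda$ and external force $f$ if $$\int_{\mathbb R^N} \rho v\cdot \nabla \psi \,dx=0 \qquad \text{for all } \psi\in C_0^\infty(\mathbb R^N),$$ and $$\int_{\mathbb R^N} \rho\, v\otimes v :\nabla \phi \,dx=-\int_{\mathbb R^N} p\,\mathrm{div}\,\phi\,dx-\mu\int_{\mathbb R^N} v\cdot \Delta \phi\, dx-(\mu +\lambda)\int_{\mathbb R^N} v\cdot \nabla\, \mathrm{div}\, \phi \, dx-\int_{\mathbb R^N} f\cdot \phi \, dx$$ for all $\phi\in [C_0^\infty(\mathbb R^N)]^N$. Here $v\otimes v:\nabla\phi=\sum_{i,j}v_iv_j\,\partial_j\phi_i$. *)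

theory Defs
  imports "HOL-Analysis.Analysis"
begin

section \<open>Differential operators on $\mathbb{R}^N$, with $N$ rendered as \<open>CARD('n)\<close>\<close>

definition partial :: "'n \<Rightarrow> (real^'n \<Rightarrow> 'b::real_normed_vector) \<Rightarrow> real^'n \<Rightarrow> 'b"
  where "partial i u x = frechet_derivative u (at x) (axis i 1)"

definition grad :: "(real^'n \<Rightarrow> real) \<Rightarrow> real^'n \<Rightarrow> real^'n"
  where "grad u x = (\<chi> i. partial i u x)"

definition dvg :: "(real^'n \<Rightarrow> real^'n) \<Rightarrow> real^'n \<Rightarrow> real"
  where "dvg w x = (\<Sum>i\<in>UNIV. partial i (\<lambda>y. w y $ i) x)"

definition laplacian :: "(real^'n \<Rightarrow> 'b::real_normed_vector) \<Rightarrow> real^'n \<Rightarrow> 'b"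
  where "laplacian u x = (\<Sum>i\<in>UNIV. partial i (partial i u) x)"

text \<open>The contraction $a \otimes a : \nabla w = \sum_{i,j} a_i a_j \partial_j w_i$ at the point \<open>x\<close>.\<close>

definition tensor_contract :: "real^'n \<Rightarrow> (real^'n \<Rightarrow> real^'n) \<Rightarrow> real^'n \<Rightarrow> real"
  where "tensor_contract a w x = (\<Sum>i\<in>UNIV. \<Sum>j\<in>UNIV. a $ i * a $ j * partial j (\<lambda>y. w y $ i) x)"


section \<open>Test functions\<close>

primrec Ck :: "nat \<Rightarrow> (real^'n \<Rightarrow> 'b::real_normed_vector) \<Rightarrow> bool"
  where
    "Ck 0 u \<longleftrightarrow> continuous_on UNIV u"
  | "Ck (Suc k) u \<longleftrightarrow> (\<forall>x. u differentiable (at x)) \<and> (\<forall>i. Ck k (partial i u))"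

text \<open>The space $C_0^\infty$; with codomain \<open>real^'n\<close> it is $[C_0^\infty(\mathbb{R}^N)]^N$.\<close>

definition test_function :: "(real^'n \<Rightarrow> 'b::real_normed_vector) \<Rightarrow> bool"
  where "test_function u \<longleftrightarrow> (\<forall>k. Ck k u) \<and> compact (closure {x. u x \<noteq> 0})"


section \<open>Local Lebesgue spaces\<close>

definition L1_loc :: "(real^'n \<Rightarrow> 'b::euclidean_space) \<Rightarrow> bool"
  where "L1_loc u \<longleftrightarrow> u \<in> borel_measurable lebesgue \<and>
    (\<forall>K. compact K \<longrightarrow> set_integrable lebesgue K u)"

definition L2_loc :: "(real^'n \<Rightarrow> 'b::euclidean_space) \<Rightarrow> bool"
  where "L2_loc u \<longleftrightarrow> u \<in> borel_measurable lebesgue \<and>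
    (\<forall>K. compact K \<longrightarrow> set_integrable lebesgue K (\<lambda>x. (norm (u x))\<^sup>2))"

definition Linf_loc :: "(real^'n \<Rightarrow> 'b::euclidean_space) \<Rightarrow> bool"
  where "Linf_loc u \<longleftrightarrow> u \<in> borel_measurable lebesgue \<and>
    (\<forall>K. compact K \<longrightarrow> (\<exists>C. AE x in lebesgue. x \<in> K \<longrightarrow> norm (u x) \<le> C))"

definition weakly_divergence_free :: "(real^'n \<Rightarrow> real^'n) \<Rightarrow> bool"
  where "weakly_divergence_free f \<longleftrightarrow>
    (\<forall>\<psi>. test_function \<psi> \<longrightarrow> (LINT x|lebesgue. f x \<bullet> grad \<psi> x) = 0)"


section \<open>Stationary weak solutions\<close>

text \<open>A pressure law is a function on $[0,\infty) \times \mathbb{R}$; the values of \<open>p\<close> at negative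
  densities are irrelevant. Lebesgue measurability covers Borel measurability as well.\<close>

definition pressure_law :: "(real \<times> real \<Rightarrow> real) \<Rightarrow> bool"
  where "pressure_law p \<longleftrightarrow>
    p \<in> borel_measurable (lebesgue_on ({0..} \<times> UNIV)) \<and>
    (\<forall>r s. 0 \<le> r \<longrightarrow> 0 \<le> p (r, s)) \<and>
    (\<forall>r s. 0 \<le> r \<longrightarrow> p (r, s) = 0 \<longrightarrow> r = 0)"

definition stationary_weak_solution ::
  "(real \<times> real \<Rightarrow> real) \<Rightarrow> real \<Rightarrow> real \<Rightarrow> (real^'n \<Rightarrow> real^'n) \<Rightarrow>
   (real^'n \<Rightarrow> real) \<Rightarrow> (real^'n \<Rightarrow> real^'n) \<Rightarrow> (real^'n \<Rightarrow> real) \<Rightarrow> bool"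
  where "stationary_weak_solution p mu lam f \<rho> v S \<longleftrightarrow>
    L2_loc v \<and>
    Linf_loc \<rho> \<and> (AE x in lebesgue. 0 \<le> \<rho> x) \<and>
    Linf_loc S \<and>
    L1_loc (\<lambda>x. p (\<rho> x, S x)) \<and>
    (\<forall>\<psi>. test_function \<psi> \<longrightarrow> (LINT x|lebesgue. \<rho> x * (v x \<bullet> grad \<psi> x)) = 0) \<and>
    (\<forall>\<phi>. test_function \<phi> \<longrightarrow>
      (LINT x|lebesgue. \<rho> x * tensor_contract (v x) \<phi> x) =
        - (LINT x|lebesgue. p (\<rho> x, S x) * dvg \<phi> x)
        - mu * (LINT x|lebesgue. v x \<bullet> laplacian \<phi> x)
        - (mu + lam) * (LINT x|lebesgue. v x \<bullet> grad (dvg \<phi>) x)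
        - (LINT x|lebesgue. f x \<bullet> \<phi> x))"

end

theory Submission
  imports Defs
begin

text \<open>Test the momentum equation with the compactly supported gradient $\phi = \nabla\psi$: the force drops
  out, the two viscous terms merge into $(2\mu+\lambda) \int v \cdot \nabla\Delta\psi$, and what remains is
  $\int (\rho\, v \otimes v : D^2\psi + p\,\Delta\psi) = -(2\mu+\lambda) \int v \cdot \nabla\Delta\psi$. If
  $\psi = \psi_R$ converges, as $R \to \infty$, to a convex function with positive Laplacian, and the
  right-hand side tends to 0, then dominated convergence gives $p = 0$, hence $\rho = 0$, almost everywhere.

  Let $g(t) = -e^{-1/(1-t)}$ for $t < 1$ and $g(t) = 0$ otherwise, so that $g'(0) > 0$. If $2\mu+\lambda = 0$,
  take $\psi_R(x) = R\, g(\sqrt{1+|x|^2}/R)$: its Hessian is $O(1/(1+|x|))$ uniformly in $R$ and converges to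
  that of $g'(0) \sqrt{1+|x|^2}$. Otherwise take $\psi_R(x) = R^2 g(|x|^2/R^2)$, whose Hessian is bounded and
  converges to $2 g'(0) I$, while $\nabla\Delta\psi_R = O(1/R)$ is supported in $|x| \le R$; there
  $|v|/R$ is compared with $|v|^{N/(N-1)}$.\<close>

section \<open>Calculus of $C^k$ functions\<close>

lemma partial_eqI: "(u has_derivative u') (at x) \<Longrightarrow> partial i u x = u' (axis i 1)"
  unfolding partial_def by (metis frechet_derivative_at)

lemma has_derivative_frechet:
  "u differentiable (at x) \<Longrightarrow> (u has_derivative frechet_derivative u (at x)) (at x)"
  by (simp add: frechet_derivative_works)

lemma partial_const: "partial i (\<lambda>x. c) = (\<lambda>x. 0)"
  by (rule ext, subst partial_eqI) (auto intro!: derivative_eq_intros)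

lemma partial_nth: "partial i (\<lambda>x. x $ j) = (\<lambda>x. if i = j then 1 else 0)"
  by (rule ext, subst partial_eqI[of _ "\<lambda>x. x $ j"])
    (auto intro!: bounded_linear_imp_has_derivative bounded_linear_vec_nth simp: axis_def)

lemma partial_add:
  assumes "u differentiable (at x)" "w differentiable (at x)"
  shows "partial i (\<lambda>x. u x + w x) x = partial i u x + partial i w x"
  using partial_eqI[OF has_derivative_add[OF assms[THEN has_derivative_frechet]]]
  by (simp add: partial_def)

lemma partial_mult:
  fixes u w :: "real^'n \<Rightarrow> real"
  assumes "u differentiable (at x)" "w differentiable (at x)"
  shows "partial i (\<lambda>x. u x * w x) x = u x * partial i w x + partial i u x * w x"
  using partial_eqI[OF has_derivative_mult[OF assms[THEN has_derivative_frechet]]]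
  by (simp add: partial_def)

lemma has_derivative_chain_real:
  assumes "(f has_real_derivative d) (at (u x))" "(u has_derivative u') (at x)"
  shows "((\<lambda>x. f (u x)) has_derivative (\<lambda>e. d * u' e)) (at x)"
  using has_derivative_compose[OF assms(2) assms(1)[unfolded has_field_derivative_def]]
  by simp

lemma partial_chain:
  assumes "(f has_real_derivative d) (at (u x))" "u differentiable (at x)"
  shows "partial i (\<lambda>x. f (u x)) x = d * partial i u x"
  using partial_eqI[OF has_derivative_chain_real[OF assms(1) has_derivative_frechet[OF assms(2)]]]
  by (simp add: partial_def)

lemma differentiable_chain_real:
  assumes "(f has_real_derivative d) (at (u x))" "u differentiable (at x)"
  shows "(\<lambda>x. f (u x)) differentiable (at x)"
  using has_derivative_chain_real[OF assms(1) has_derivative_frechet[OF assms(2)]]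
  by (rule differentiableI)

lemma partial_vec:
  fixes u :: "'m::finite \<Rightarrow> real^'n \<Rightarrow> real"
  assumes "\<And>j. u j differentiable (at x)"
  shows differentiable_vec: "(\<lambda>x. \<chi> j. u j x) differentiable (at x)"
    and "partial i (\<lambda>x. \<chi> j. u j x) x = (\<chi> j. partial i (u j) x)"
proof -
  have d: "((\<lambda>x. \<chi> j. u j x) has_derivative (\<lambda>e. \<chi> j. frechet_derivative (u j) (at x) e)) (at x)"
    by (subst has_derivative_componentwise_within)
      (use assms in \<open>auto simp: Basis_vec_def inner_axis has_derivative_frechet\<close>)
  show "(\<lambda>x. \<chi> j. u j x) differentiable (at x)" by (rule differentiableI[OF d])
  show "partial i (\<lambda>x. \<chi> j. u j x) x = (\<chi> j. partial i (u j) x)"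
    by (subst partial_eqI[OF d]) (simp add: partial_def)
qed

text \<open>\<open>Ck (Suc k)\<close> states continuity only for the derivatives of highest order,
  so the base case is that differentiability implies continuity. Product and chain rule need this to
  lower the order of the factor left undifferentiated.\<close>

lemma Ck_SucD: "Ck (Suc k) u \<Longrightarrow> Ck k u"
proof (induction k arbitrary: u)
  case 0
  then show ?case
    by (auto intro!: continuous_at_imp_continuous_on differentiable_imp_continuous_within)
qed auto

lemma Ck_const: "Ck k (\<lambda>x. c)"
  by (induction k arbitrary: c) (auto simp: partial_const)

lemma Ck_nth: "Ck k (\<lambda>x. x $ i)"
  by (cases k) (auto simp: partial_nth Ck_const intro!: continuous_intros
      bounded_linear_imp_differentiable bounded_linear_vec_nth)

lemma Ck_add: "Ck k u \<Longrightarrow> Ck k w \<Longrightarrow> Ck k (\<lambda>x. u x + w x)"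
proof (induction k arbitrary: u w)
  case (Suc k)
  then have "partial i (\<lambda>x. u x + w x) = (\<lambda>x. partial i u x + partial i w x)" for i
    by (intro ext partial_add) auto
  with Suc show ?case by auto
qed (auto intro: continuous_intros)

lemma Ck_mult:
  fixes u w :: "real^'n \<Rightarrow> real"
  shows "Ck k u \<Longrightarrow> Ck k w \<Longrightarrow> Ck k (\<lambda>x. u x * w x)"
proof (induction k arbitrary: u w)
  case (Suc k)
  then have "partial i (\<lambda>x. u x * w x) = (\<lambda>x. u x * partial i w x + partial i u x * w x)" for i
    by (intro ext partial_mult) auto
  with Suc Ck_SucD[OF Suc.prems(1)] Ck_SucD[OF Suc.prems(2)] show ?case
    by (auto intro!: Ck_add)
qed (auto intro: continuous_intros)

lemma Ck_sum: "(\<And>i. i \<in> I \<Longrightarrow> Ck k (u i)) \<Longrightarrow> Ck k (\<lambda>x. \<Sum>i\<in>I. u i x)"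
  by (induction I rule: infinite_finite_induct) (auto intro: Ck_const Ck_add)

lemma Ck_inner_self: "Ck k (\<lambda>x::real^'n. x \<bullet> x)"
  unfolding inner_vec_def by (auto intro!: Ck_sum Ck_mult Ck_nth)

text \<open>The exponent varies in the induction because each derivative replaces \<open>a\<close>
  by \<open>a - 1\<close>; positivity of \<open>u\<close> keeps away from the singularity of the
  power at 0.\<close>

lemma Ck_powr:
  fixes u :: "real^'n \<Rightarrow> real"
  assumes "\<And>x. u x > 0"
  shows "Ck k u \<Longrightarrow> Ck k (\<lambda>x. u x powr a)"
proof (induction k arbitrary: a)
  case 0
  then show ?case using assms by (auto intro!: continuous_intros simp: less_imp_neq[symmetric])
next
  case (Suc k)
  have d: "((\<lambda>t. t powr a) has_real_derivative a * u x powr (a - 1)) (at (u x))" for x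
    using assms by (rule has_real_derivative_powr)
  have "partial i (\<lambda>x. u x powr a) = (\<lambda>x. a * u x powr (a - 1) * partial i u x)" for i
    using Suc.prems by (intro ext partial_chain d) auto
  moreover have "(\<lambda>x. u x powr a) differentiable (at x)" for x
    by (rule differentiable_chain_real[where u = u], rule d) (use Suc.prems in auto)
  ultimately show ?case
    using Suc Ck_SucD[OF Suc.prems] by (auto intro!: Ck_mult Ck_const)
qed

lemma Ck_vec:
  fixes u :: "'m::finite \<Rightarrow> real^'n \<Rightarrow> real"
  shows "(\<And>j. Ck k (u j)) \<Longrightarrow> Ck k (\<lambda>x. \<chi> j. u j x)"
proof (induction k arbitrary: u)
  case 0
  then show ?case by (auto intro!: continuous_on_vec_lambda)
next
  case (Suc k)
  then have "partial i (\<lambda>x. \<chi> j. u j x) = (\<lambda>x. \<chi> j. partial i (u j) x)" for i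
    by (intro ext partial_vec) auto
  with Suc show ?case by (auto intro: differentiable_vec)
qed

text \<open>Off the closed support the function is locally zero, hence so is its derivative. This
  makes gradients admissible in the momentum equation.\<close>

lemma test_function_grad:
  fixes \<psi> :: "real^'n \<Rightarrow> real"
  assumes "test_function \<psi>"
  shows "test_function (grad \<psi>)"
proof -
  have "Ck k (grad \<psi>)" for k
  proof -
    have "Ck (Suc k) \<psi>" using assms unfolding test_function_def by blast
    then show ?thesis unfolding grad_def[abs_def] by (intro Ck_vec) auto
  qed
  moreover have "{x. grad \<psi> x \<noteq> 0} \<subseteq> closure {x. \<psi> x \<noteq> 0}"
  proof (rule subsetI, rule ccontr)
    fix x assume x: "x \<in> {x. grad \<psi> x \<noteq> 0}" "x \<notin> closure {x. \<psi> x \<noteq> 0}"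
    have "((\<lambda>_. 0) has_derivative (\<lambda>_. 0)) (at x)" by simp
    then have "(\<psi> has_derivative (\<lambda>_. 0)) (at x)"
    proof (rule has_derivative_transform_within_open)
      show "open (- closure {x. \<psi> x \<noteq> 0})" "x \<in> - closure {x. \<psi> x \<noteq> 0}"
        using x by auto
      show "0 = \<psi> y" if "y \<in> - closure {x. \<psi> x \<noteq> 0}" for y
        using that closure_subset[of "{x. \<psi> x \<noteq> 0}"] by auto
    qed
    then have "grad \<psi> x = 0"
      by (simp add: grad_def partial_eqI vec_eq_iff)
    with x show False by simp
  qed
  then have "bounded {x. grad \<psi> x \<noteq> 0}"
    using assms unfolding test_function_def by (blast intro: bounded_subset compact_imp_bounded)
  then have "compact (closure {x. grad \<psi> x \<noteq> 0})"
    by simp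
  ultimately show ?thesis unfolding test_function_def by blast
qed

section \<open>Flat functions\<close>

text \<open>The family $e^{-1/s} s^{-m}$ is closed under differentiation up to linear combinations, which makes
  smoothness a plain induction.\<close>

definition flat_exp :: "nat \<Rightarrow> real \<Rightarrow> real"
  where "flat_exp m s = (if s > 0 then exp (- 1 / s) / s ^ m else 0)"

lemma flat_exp_nonpos: "s \<le> 0 \<Longrightarrow> flat_exp m s = 0"
  by (simp add: flat_exp_def)

text \<open>Substituting \<open>y = 1 / s\<close> turns the right-hand limit into the decay of
  \<open>y ^ m / exp y\<close> at infinity; on the left the function is identically zero.\<close>

lemma tendsto_flat_exp_0: "(flat_exp m \<longlongrightarrow> 0) (at 0)"
proof -
  have "((\<lambda>y::real. y ^ m / exp y) \<longlongrightarrow> 0) at_top" by (rule tendsto_power_div_exp_0)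
  then have "((\<lambda>s::real. inverse s ^ m / exp (inverse s)) \<longlongrightarrow> 0) (at_right 0)"
    by (rule filterlim_compose) (rule filterlim_inverse_at_top_right)
  moreover have "\<forall>\<^sub>F s in at_right 0. inverse s ^ m / exp (inverse s) = flat_exp m s"
    by (auto simp: eventually_at_filter flat_exp_def exp_minus field_simps)
  ultimately have "(flat_exp m \<longlongrightarrow> 0) (at_right 0)"
    by (rule Lim_transform_eventually)
  moreover have "(flat_exp m \<longlongrightarrow> 0) (at_left 0)"
    by (rule tendsto_eventually) (auto simp: eventually_at_filter flat_exp_def)
  ultimately show ?thesis by (simp add: filterlim_at_split)
qed

lemma has_real_derivative_flat_exp:
  "(flat_exp m has_real_derivative flat_exp (m + 2) s - m * flat_exp (m + 1) s) (at s)"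
proof (cases s "0 :: real" rule: linorder_cases)
  case less
  have "((\<lambda>_. 0) has_real_derivative 0) (at s)" by simp
  then have "(flat_exp m has_real_derivative 0) (at s)"
    by (rule has_field_derivative_transform_within_open[where S="{..<0}"])
      (use less in \<open>auto simp: flat_exp_def\<close>)
  then show ?thesis using less by (simp add: flat_exp_def)
next
  case equal
  \<comment> \<open>At 0 the difference quotient belongs to the family again: dividing by
    \<open>h\<close> raises the index by one.\<close>
  have "((\<lambda>h. flat_exp (Suc m) h) \<longlongrightarrow> 0) (at 0)" by (rule tendsto_flat_exp_0)
  then have "((\<lambda>h. (flat_exp m (0 + h) - flat_exp m 0) / h) \<longlongrightarrow> 0) (at 0)"
    by (rule Lim_transform_eventually) (auto simp: flat_exp_def eventually_at_filter)
  then show ?thesis using equal by (simp add: DERIV_def flat_exp_def)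
next
  case greater
  \<comment> \<open>Differentiating a power produces the truncated exponent
    \<open>m - Suc 0\<close>; for \<open>m = 0\<close> the factor \<open>m\<close> makes both sides
    zero.\<close>
  have p: "real m * s ^ (m - Suc 0) = m * s ^ m / s"
    using greater by (cases m) auto
  have "((\<lambda>s. exp (- 1 / s) / s ^ m) has_real_derivative
      flat_exp (m + 2) s - m * flat_exp (m + 1) s) (at s)"
    using greater
    by (auto intro!: derivative_eq_intros simp: flat_exp_def p)
      (simp add: field_simps power2_eq_square)
  then show ?thesis
    by (rule has_field_derivative_transform_within_open[where S="{0<..}"])
      (use greater in \<open>auto simp: flat_exp_def\<close>)
qed

lemma continuous_on_flat_exp: "continuous_on A (flat_exp m)"
  by (intro continuous_at_imp_continuous_on ballI DERIV_isCont[OF has_real_derivative_flat_exp])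

text \<open>Compactness settles the interval from 0 to 1, and the function is zero to its left. The
  range \<open>s \<le> 1\<close> is where the arguments of the cutoff profiles below lie.\<close>

lemma flat_exp_bounded:
  obtains C where "\<And>s. s \<le> 1 \<Longrightarrow> \<bar>flat_exp m s\<bar> \<le> C"
proof -
  have "bounded (flat_exp m ` {0..1})"
    by (intro compact_imp_bounded compact_continuous_image continuous_on_flat_exp) auto
  then obtain C where C: "C > 0" "\<And>s. s \<in> {0..1} \<Longrightarrow> \<bar>flat_exp m s\<bar> \<le> C"
    unfolding bounded_pos by auto
  have "\<bar>flat_exp m s\<bar> \<le> C" if "s \<le> 1" for s
    using that C by (cases "s \<ge> 0") (auto simp: flat_exp_nonpos)
  then show ?thesis using that by blast
qed

text \<open>The index \<open>m\<close> varies in the induction, since differentiation leads to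
  \<open>m + 1\<close> and \<open>m + 2\<close>.\<close>

lemma Ck_flat_exp: "Ck k u \<Longrightarrow> Ck k (\<lambda>x. flat_exp m (u x))"
proof (induction k arbitrary: m)
  case 0
  then show ?case using continuous_on_compose2[OF continuous_on_flat_exp[of UNIV]] by auto
next
  case (Suc k)
  note d = has_real_derivative_flat_exp
  have "partial i (\<lambda>x. flat_exp m (u x)) = (\<lambda>x. (flat_exp (m + 2) (u x) +
      (- real m) * flat_exp (m + 1) (u x)) * partial i u x)" for i
    using Suc.prems by (intro ext) (simp add: partial_chain[where u = u, OF d])
  moreover have "(\<lambda>x. flat_exp m (u x)) differentiable (at x)" for x
    by (rule differentiable_chain_real[where u = u], rule d) (use Suc.prems in auto)
  moreover have "Ck k (\<lambda>x. (flat_exp (m + 2) (u x) +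
      (- real m) * flat_exp (m + 1) (u x)) * partial i u x)" for i
    by (intro Ck_mult Ck_add Ck_const) (use Suc Ck_SucD[OF Suc.prems] in auto)
  ultimately show ?case by simp
qed

section \<open>Gradients of radial functions\<close>

lemma partial_inner_self: "partial i (\<lambda>x. x \<bullet> x) x = 2 * x $ i"
proof -
  have "((\<lambda>x. x \<bullet> x) has_derivative (\<lambda>e. 2 * (x \<bullet> e))) (at x)"
    by (auto intro!: derivative_eq_intros simp: inner_commute)
  from partial_eqI[OF this] show ?thesis by (simp add: inner_axis)
qed

lemma differentiable_inner_self: "(\<lambda>x::real^'n. x \<bullet> x) differentiable (at x)"
  using Ck_inner_self[of 1] by simp

lemma differentiable_nth: "(\<lambda>x. x $ i) differentiable (at (x::real^'n))"
  using Ck_nth[of 1 i] by simp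

text \<open>Radial functions are written through \<open>x \<bullet> x\<close> instead of the norm,
  so that the chain rule also covers the origin, where the norm is not differentiable.\<close>

lemma partial_radial:
  assumes "(h has_real_derivative d) (at (x \<bullet> x))"
  shows "partial i (\<lambda>x. h (x \<bullet> x)) x = 2 * d * x $ i"
  by (simp add: partial_chain[where u = "\<lambda>x. x \<bullet> x", OF assms differentiable_inner_self] partial_inner_self)

lemma differentiable_radial:
  fixes x :: "real^'n"
  assumes "(h has_real_derivative d) (at (x \<bullet> x))"
  shows "(\<lambda>x. h (x \<bullet> x)) differentiable (at x)"
  by (rule differentiable_chain_real[where u = "\<lambda>x. x \<bullet> x", OF assms differentiable_inner_self])

lemma grad_radial:
  assumes "\<And>s. s \<ge> 0 \<Longrightarrow> (h has_real_derivative h' s) (at s)"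
  shows "grad (\<lambda>x::real^'n. h (x \<bullet> x)) = (\<lambda>x. \<chi> i. (2 * h' (x \<bullet> x)) * x $ i)"
  unfolding grad_def[abs_def] by (intro ext) (simp add: partial_radial[OF assms])

lemma partial_radial_nth:
  fixes h h' :: "real \<Rightarrow> real" and x :: "real^'n"
  assumes h: "\<And>s. s \<ge> 0 \<Longrightarrow> (h has_real_derivative h' s) (at s)"
  shows "partial j (\<lambda>x. h (x \<bullet> x) * x $ i) x =
      h (x \<bullet> x) * (if i = j then 1 else 0) + 2 * h' (x \<bullet> x) * x $ i * x $ j"
    and differentiable_radial_nth: "(\<lambda>x. h (x \<bullet> x) * x $ i) differentiable (at x)"
  using partial_mult[OF differentiable_radial[OF h] differentiable_nth, of x j i]
    differentiable_mult[OF differentiable_radial[OF h] differentiable_nth, of x i]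
  by (auto simp: partial_radial[OF h] partial_nth)

section \<open>Derivatives of a radial potential up to third order\<close>

context
  fixes h0 h1 h2 h3 :: "real \<Rightarrow> real"
  assumes h0: "\<And>s. s \<ge> 0 \<Longrightarrow> (h0 has_real_derivative h1 s) (at s)"
    and h1: "\<And>s. s \<ge> 0 \<Longrightarrow> (h1 has_real_derivative h2 s) (at s)"
    and h2: "\<And>s. s \<ge> 0 \<Longrightarrow> (h2 has_real_derivative h3 s) (at s)"
begin

text \<open>The Hessian of the potential is \<open>2 * h1\<close> times the identity plus
  \<open>4 * h2\<close> times the tensor square of \<open>x\<close>; the contraction and the
  divergence below are read off from it.\<close>

lemma partial_grad_radial_nth:
  "partial j (\<lambda>y. grad (\<lambda>x. h0 (x \<bullet> x)) y $ i) =
    (\<lambda>x. 2 * h1 (x \<bullet> x) * (if i = j then 1 else 0) + 4 * h2 (x \<bullet> x) * x $ i * x $ j)"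
proof -
  have "((\<lambda>s. 2 * h1 s) has_real_derivative 2 * h2 s) (at s)" if "s \<ge> 0" for s
    using h1[OF that] by (auto intro!: derivative_eq_intros)
  note d = partial_radial_nth(1)[OF this]
  show ?thesis
    by (intro ext) (simp add: grad_radial[OF h0] d)
qed

lemma tensor_contract_grad_radial:
  "tensor_contract a (grad (\<lambda>x. h0 (x \<bullet> x))) x =
    2 * h1 (x \<bullet> x) * (norm a)\<^sup>2 + 4 * h2 (x \<bullet> x) * (x \<bullet> a)\<^sup>2"
proof -
  have "(norm a)\<^sup>2 = (\<Sum>i\<in>UNIV. \<Sum>j\<in>UNIV. a $ i * a $ j * (if i = j then 1 else 0))"
    by (simp add: power2_norm_eq_inner inner_vec_def if_distrib sum.delta cong: if_cong)
  moreover have "(x \<bullet> a)\<^sup>2 = (\<Sum>i\<in>UNIV. \<Sum>j\<in>UNIV. a $ i * a $ j * (x $ i * x $ j))"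
    by (simp add: inner_vec_def power2_eq_square sum_product mult_ac)
  ultimately show ?thesis
    unfolding tensor_contract_def partial_grad_radial_nth
    by (simp add: sum_distrib_left sum.distrib[symmetric] algebra_simps)
qed

lemma dvg_grad_radial:
  "dvg (grad (\<lambda>x::real^'n. h0 (x \<bullet> x))) =
    (\<lambda>x. 2 * CARD('n) * h1 (x \<bullet> x) + 4 * (x \<bullet> x) * h2 (x \<bullet> x))"
  unfolding dvg_def[abs_def] partial_grad_radial_nth
  by (auto simp: sum.distrib inner_vec_def sum_distrib_left sum_distrib_right mult_ac)

lemma grad_dvg_grad_radial:
  "grad (dvg (grad (\<lambda>x::real^'n. h0 (x \<bullet> x)))) =
    (\<lambda>x. (4 * (CARD('n) + 2) * h2 (x \<bullet> x) + 8 * (x \<bullet> x) * h3 (x \<bullet> x)) *\<^sub>R x)"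
proof -
  have "((\<lambda>s. 2 * CARD('n) * h1 s + 4 * s * h2 s) has_real_derivative
      2 * CARD('n) * h2 s + (4 * h2 s + 4 * s * h3 s)) (at s)" if "s \<ge> 0" for s
    using h1[OF that] h2[OF that] by (auto intro!: derivative_eq_intros)
  from grad_radial[where 'n = 'n, OF this] show ?thesis
    unfolding dvg_grad_radial by (simp add: fun_eq_iff vec_eq_iff algebra_simps)
qed

text \<open>The result agrees with \<open>grad_dvg_grad_radial\<close> because the Laplacian of a
  gradient is the gradient of the Laplacian. It is verified here by explicit computation, and it
  lets the two viscous terms combine.\<close>

lemma laplacian_grad_radial:
  "laplacian (grad (\<lambda>x::real^'n. h0 (x \<bullet> x))) =
    (\<lambda>x. (4 * (CARD('n) + 2) * h2 (x \<bullet> x) + 8 * (x \<bullet> x) * h3 (x \<bullet> x)) *\<^sub>R x)"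
proof -
  have d1: "((\<lambda>s. 2 * h1 s) has_real_derivative 2 * h2 s) (at s)" if "s \<ge> 0" for s
    using h1[OF that] by (auto intro!: derivative_eq_intros)
  have d2: "((\<lambda>s. 4 * h2 s) has_real_derivative 4 * h3 s) (at s)" if "s \<ge> 0" for s
    using h2[OF that] by (auto intro!: derivative_eq_intros)
  have *: "partial j (grad (\<lambda>x::real^'n. h0 (x \<bullet> x))) =
      (\<lambda>x. \<chi> i. 2 * h1 (x \<bullet> x) * (if i = j then 1 else 0) + 4 * h2 (x \<bullet> x) * x $ i * x $ j)" for j
  proof -
    have "grad (\<lambda>x::real^'n. h0 (x \<bullet> x)) = (\<lambda>x. \<chi> i. (2 * h1 (x \<bullet> x)) * x $ i)"
      by (rule grad_radial[OF h0])
    then show ?thesis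
      by (intro ext) (simp add: partial_vec(2) differentiable_radial_nth[OF d1] partial_radial_nth[OF d1])
  qed
  \<comment> \<open>Summed over \<open>j\<close>, the first term contributes
    \<open>4 * N * h2\<close>, the diagonal one \<open>8 * h2\<close> and the last one
    \<open>8 * (x \<bullet> x) * h3\<close>, each times \<open>x $ i\<close>, where N is the
    dimension.\<close>
  have "partial j (partial j (grad (\<lambda>x::real^'n. h0 (x \<bullet> x)))) x $ i =
      4 * h2 (x \<bullet> x) * x $ i + (if i = j then 8 * h2 (x \<bullet> x) * x $ i else 0)
        + 8 * h3 (x \<bullet> x) * x $ i * (x $ j * x $ j)" for j i x
  proof -
    have e: "partial j (\<lambda>x. 2 * h1 (x \<bullet> x) * (if i = j then 1 else 0) + 4 * h2 (x \<bullet> x) * x $ i * x $ j) x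
      = 4 * h2 (x \<bullet> x) * x $ i + (if i = j then 8 * h2 (x \<bullet> x) * x $ i else 0)
        + 8 * h3 (x \<bullet> x) * x $ i * (x $ j * x $ j)"
      (is "partial j (?u i) x = _") for i
    proof -
      have "partial j (?u i) x = partial j (\<lambda>x. 2 * h1 (x \<bullet> x) * (if i = j then 1 else 0)) x
          + partial j (\<lambda>x. 4 * h2 (x \<bullet> x) * x $ i * x $ j) x"
        by (intro partial_add differentiable_mult differentiable_radial[OF d1]
            differentiable_radial_nth[OF d2] differentiable_nth) auto
      also have "partial j (\<lambda>x. 2 * h1 (x \<bullet> x) * (if i = j then 1 else 0)) x =
          (if i = j then 4 * h2 (x \<bullet> x) * x $ i else 0)"
        by (auto simp: partial_radial[OF d1] partial_const)
      also have "partial j (\<lambda>x. 4 * h2 (x \<bullet> x) * x $ i * x $ j) x =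
          4 * h2 (x \<bullet> x) * x $ i +
          (4 * h2 (x \<bullet> x) * (if i = j then 1 else 0) + 2 * (4 * h3 (x \<bullet> x)) * x $ i * x $ j) * x $ j"
        by (subst partial_mult)
          (auto simp: partial_radial_nth[OF d2] partial_nth
            intro!: differentiable_radial_nth[OF d2] differentiable_nth)
      finally show ?thesis by (auto simp: algebra_simps)
    qed
    have "(\<lambda>x. 2 * h1 (x \<bullet> x) * (if i = j then 1 else 0) + 4 * h2 (x \<bullet> x) * x $ i * x $ j)
        differentiable (at x)" for i
      by (intro differentiable_add differentiable_mult differentiable_radial[OF d1]
            differentiable_radial_nth[OF d2] differentiable_nth) auto
    then show ?thesis unfolding * by (subst partial_vec) (auto simp: e)
  qed
  then show ?thesis unfolding laplacian_def[abs_def]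
    by (auto simp: fun_eq_iff vec_eq_iff sum.distrib inner_vec_def sum_distrib_left algebra_simps)
qed

text \<open>Both viscous integrals have the same integrand, so their factors \<open>mu\<close> and
  \<open>mu + lam\<close> add up; the force integral is zero because the test field is a
  gradient.\<close>

lemma momentum_radial:
  fixes f v :: "real^'n \<Rightarrow> real^'n" and \<rho> S :: "real^'n \<Rightarrow> real"
  assumes sol: "stationary_weak_solution p mu lam f \<rho> v S" and f: "weakly_divergence_free f"
    and test: "test_function (\<lambda>x::real^'n. h0 (x \<bullet> x))"
  shows "(LINT x|lebesgue. \<rho> x * (2 * h1 (x \<bullet> x) * (norm (v x))\<^sup>2 + 4 * h2 (x \<bullet> x) * (x \<bullet> v x)\<^sup>2)) =
    - (LINT x|lebesgue. p (\<rho> x, S x) * (2 * CARD('n) * h1 (x \<bullet> x) + 4 * (x \<bullet> x) * h2 (x \<bullet> x)))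
    - (2 * mu + lam) * (LINT x|lebesgue.
        (4 * (CARD('n) + 2) * h2 (x \<bullet> x) + 8 * (x \<bullet> x) * h3 (x \<bullet> x)) * (x \<bullet> v x))"
proof -
  let ?\<phi> = "grad (\<lambda>x::real^'n. h0 (x \<bullet> x))"
  have "(LINT x|lebesgue. \<rho> x * tensor_contract (v x) ?\<phi> x) =
        - (LINT x|lebesgue. p (\<rho> x, S x) * dvg ?\<phi> x)
        - mu * (LINT x|lebesgue. v x \<bullet> laplacian ?\<phi> x)
        - (mu + lam) * (LINT x|lebesgue. v x \<bullet> grad (dvg ?\<phi>) x)
        - (LINT x|lebesgue. f x \<bullet> ?\<phi> x)"
    using sol test_function_grad[OF test] unfolding stationary_weak_solution_def by blast
  moreover have "(LINT x|lebesgue. f x \<bullet> ?\<phi> x) = 0"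
    using f test unfolding weakly_divergence_free_def by blast
  ultimately show ?thesis
    unfolding laplacian_grad_radial grad_dvg_grad_radial
    unfolding dvg_grad_radial tensor_contract_grad_radial
    by (simp add: inner_commute algebra_simps)
qed

end

lemma borel_measurable_radial:
  assumes "continuous_on {0..} h"
  shows "(\<lambda>x::real^'n. h (x \<bullet> x) :: real) \<in> borel_measurable lebesgue"
proof -
  have "continuous_on UNIV (\<lambda>x::real^'n. h (x \<bullet> x))"
    by (rule continuous_on_compose2[OF assms]) (auto intro!: continuous_intros)
  then show ?thesis
    by (intro measurable_completion) (simp add: borel_measurable_continuous_onI)
qed

lemma inner_square_le: "(x \<bullet> a)\<^sup>2 \<le> (x \<bullet> x) * (norm a)\<^sup>2"
  using Cauchy_Schwarz_ineq[of x a] by (simp add: power2_norm_eq_inner)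

section \<open>Passage to the limit\<close>

text \<open>The limit argument shared by both cases. The Hessians are bounded by a multiple of
  \<open>w\<close>. The limit Hessian has eigenvalue \<open>2 * H1\<close> orthogonally to
  \<open>x\<close> and \<open>2 * (H1 + 2 * s * H2)\<close> along \<open>x\<close>, so
  \<open>pos\<close> encodes convexity. The sequence \<open>e\<close> absorbs the viscous
  term.\<close>

lemma pressure_vanishes:
  fixes v :: "real^'n \<Rightarrow> real^'n" and \<rho> q :: "real^'n \<Rightarrow> real"
    and h1 h2 :: "nat \<Rightarrow> real \<Rightarrow> real" and H1 H2 w :: "real \<Rightarrow> real"
  assumes meas [measurable]: "v \<in> borel_measurable lebesgue" "\<rho> \<in> borel_measurable lebesgue"
      "q \<in> borel_measurable lebesgue"
    and nonneg: "AE x in lebesgue. 0 \<le> \<rho> x" "AE x in lebesgue. 0 \<le> q x"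
    and w: "integrable lebesgue (\<lambda>x. (\<rho> x * (norm (v x))\<^sup>2 + q x) * w (x \<bullet> x))"
      "\<And>s. s \<ge> 0 \<Longrightarrow> 0 \<le> w s"
    and cont: "\<And>n. continuous_on {0..} (h1 n)" "\<And>n. continuous_on {0..} (h2 n)"
    and bound: "\<And>n s. s \<ge> 0 \<Longrightarrow> \<bar>h1 n s\<bar> \<le> C * w s" "\<And>n s. s \<ge> 0 \<Longrightarrow> s * \<bar>h2 n s\<bar> \<le> C * w s"
    and lim: "\<And>s. s \<ge> 0 \<Longrightarrow> (\<lambda>n. h1 n s) \<longlonglongrightarrow> H1 s" "\<And>s. s \<ge> 0 \<Longrightarrow> (\<lambda>n. h2 n s) \<longlonglongrightarrow> H2 s"
    and pos: "\<And>s. s \<ge> 0 \<Longrightarrow> 0 < H1 s" "\<And>s. s \<ge> 0 \<Longrightarrow> 0 < H1 s + 2 * s * H2 s"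
    and identity: "\<And>n. (LINT x|lebesgue. \<rho> x * (2 * h1 n (x \<bullet> x) * (norm (v x))\<^sup>2 +
        4 * h2 n (x \<bullet> x) * (x \<bullet> v x)\<^sup>2)) =
      - (LINT x|lebesgue. q x * (2 * CARD('n) * h1 n (x \<bullet> x) + 4 * (x \<bullet> x) * h2 n (x \<bullet> x))) - e n"
    and e: "e \<longlonglongrightarrow> 0"
  shows "AE x in lebesgue. q x = 0"
proof -
  define g where "g x = (\<rho> x * (norm (v x))\<^sup>2 + q x) * w (x \<bullet> x)" for x
  define A where "A n x = \<rho> x * (2 * h1 n (x \<bullet> x) * (norm (v x))\<^sup>2 +
        4 * h2 n (x \<bullet> x) * (x \<bullet> v x)\<^sup>2)" for n x
  define B where "B n x = q x * (2 * CARD('n) * h1 n (x \<bullet> x) + 4 * (x \<bullet> x) * h2 n (x \<bullet> x))" for n x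
  define A' where "A' x = \<rho> x * (2 * H1 (x \<bullet> x) * (norm (v x))\<^sup>2 +
        4 * H2 (x \<bullet> x) * (x \<bullet> v x)\<^sup>2)" for x
  define B' where "B' x = q x * (2 * CARD('n) * H1 (x \<bullet> x) + 4 * (x \<bullet> x) * H2 (x \<bullet> x))" for x
  have g: "integrable lebesgue g"
    using w(1) by (simp add: g_def[abs_def])
  note [measurable] = borel_measurable_radial[where 'n = 'n, OF cont(1)]
    borel_measurable_radial[where 'n = 'n, OF cont(2)]
  have id [measurable]: "(\<lambda>x::real^'n. x) \<in> borel_measurable lebesgue"
    by (intro measurable_completion) simp
  have sq: "(\<lambda>x::real^'n. x \<bullet> x) \<in> borel_measurable lebesgue"
    by (intro borel_measurable_inner id)
  note [measurable] = sq
  have [measurable]: "A n \<in> borel_measurable lebesgue" "B n \<in> borel_measurable lebesgue" for n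
    unfolding A_def B_def by measurable
  \<comment> \<open>Nonnegativity is read off from the bound on an absolute value, whatever the sign
    of \<open>C\<close>.\<close>
  have C: "0 \<le> C * w s" if "s \<ge> 0" for s
    using bound(1)[OF that, of 0] by linarith
  \<comment> \<open>The constants add the bounds of the two Hessian terms: \<open>2 + 4\<close> for
    the contraction with the velocity and \<open>2 * CARD('n) + 4\<close> for the trace.\<close>
  have A_le: "AE x in lebesgue. norm (A n x) \<le> norm (6 * C * g x)"
    and B_le: "AE x in lebesgue. norm (B n x) \<le> norm ((2 * CARD('n) + 4) * C * g x)" for n
  proof -
    have *: "\<bar>A n x\<bar> \<le> 6 * C * g x" "\<bar>B n x\<bar> \<le> (2 * CARD('n) + 4) * C * g x"
      if nn: "0 \<le> \<rho> x" "0 \<le> q x" for x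
    proof -
      let ?s = "x \<bullet> x" and ?a = "(norm (v x))\<^sup>2"
      have s: "?s \<ge> 0" by simp
      have "\<bar>4 * h2 n ?s * (x \<bullet> v x)\<^sup>2\<bar> = 4 * \<bar>h2 n ?s\<bar> * (x \<bullet> v x)\<^sup>2"
        by (simp add: abs_mult)
      also have "\<dots> \<le> 4 * \<bar>h2 n ?s\<bar> * (?s * ?a)"
        by (intro mult_left_mono inner_square_le) auto
      also have "\<dots> = 4 * (?s * \<bar>h2 n ?s\<bar>) * ?a" by simp
      also have "\<dots> \<le> 4 * (C * w ?s) * ?a"
        by (intro mult_right_mono mult_left_mono bound s) auto
      finally have 2: "\<bar>4 * h2 n ?s * (x \<bullet> v x)\<^sup>2\<bar> \<le> 4 * (C * w ?s) * ?a" .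
      have "\<bar>2 * h1 n ?s * ?a\<bar> = 2 * \<bar>h1 n ?s\<bar> * ?a" by (simp add: abs_mult)
      also have "\<dots> \<le> 2 * (C * w ?s) * ?a"
        by (intro mult_right_mono mult_left_mono bound s) auto
      finally have "\<bar>2 * h1 n ?s * ?a + 4 * h2 n ?s * (x \<bullet> v x)\<^sup>2\<bar> \<le> 6 * (C * w ?s) * ?a"
        using 2 by linarith
      from mult_left_mono[OF this nn(1)]
      have "\<bar>A n x\<bar> \<le> 6 * (C * w ?s) * (\<rho> x * ?a)"
        using nn by (simp add: A_def abs_mult mult_ac)
      also have "\<dots> \<le> 6 * (C * w ?s) * (\<rho> x * ?a + q x)"
        using nn C[OF s] by (intro mult_left_mono) auto
      finally show "\<bar>A n x\<bar> \<le> 6 * C * g x" by (simp only: g_def mult_ac)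
      have "\<bar>2 * CARD('n) * h1 n ?s\<bar> \<le> 2 * CARD('n) * (C * w ?s)"
        using bound(1)[OF s, of n] by (simp add: abs_mult mult_left_mono)
      moreover have "\<bar>4 * ?s * h2 n ?s\<bar> \<le> 4 * (C * w ?s)"
        using bound(2)[OF s, of n] by (simp add: abs_mult)
      ultimately have "\<bar>2 * CARD('n) * h1 n ?s + 4 * ?s * h2 n ?s\<bar> \<le> (2 * CARD('n) + 4) * (C * w ?s)"
        by (simp add: algebra_simps)
      from mult_left_mono[OF this nn(2)]
      have "\<bar>B n x\<bar> \<le> (2 * CARD('n) + 4) * (C * w ?s) * q x"
        using nn by (simp add: B_def abs_mult mult_ac)
      also have "\<dots> \<le> (2 * CARD('n) + 4) * (C * w ?s) * (\<rho> x * ?a + q x)"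
        using nn C[OF s] by (intro mult_left_mono) auto
      finally show "\<bar>B n x\<bar> \<le> (2 * CARD('n) + 4) * C * g x" by (simp add: g_def mult_ac)
    qed
    show "AE x in lebesgue. norm (A n x) \<le> norm (6 * C * g x)"
      using nonneg by eventually_elim (metis *(1) abs_ge_self order_trans real_norm_def)
    show "AE x in lebesgue. norm (B n x) \<le> norm ((2 * CARD('n) + 4) * C * g x)"
      using nonneg by eventually_elim (metis *(2) abs_ge_self order_trans real_norm_def)
  qed
  have A: "integrable lebesgue (A n)" for n
    by (rule Bochner_Integration.integrable_bound[OF _ _ A_le]) (use g in auto)
  have B: "integrable lebesgue (B n)" for n
    by (rule Bochner_Integration.integrable_bound[OF _ _ B_le]) (use g in auto)
  define G where "G x = norm (6 * C * g x) + norm ((2 * CARD('n) + 4) * C * g x)" for x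
  have tends: "(\<lambda>n. A n x + B n x) \<longlonglongrightarrow> A' x + B' x" for x
    unfolding A_def B_def A'_def B'_def by (intro tendsto_intros lim) auto
  have [measurable]: "(\<lambda>x. A' x + B' x) \<in> borel_measurable lebesgue"
    by (rule borel_measurable_LIMSEQ_real[OF tends]) measurable
  have int_G: "integrable lebesgue G"
    unfolding G_def[abs_def] using g by auto
  have dom: "AE x in lebesgue. norm (A n x + B n x) \<le> G x" for n
    using A_le[of n] B_le[of n] unfolding G_def
    by eventually_elim (rule order_trans[OF norm_triangle_ineq add_mono])
  have conv: "(\<lambda>n. LINT x|lebesgue. A n x + B n x) \<longlonglongrightarrow> (LINT x|lebesgue. A' x + B' x)"
    and int: "integrable lebesgue (\<lambda>x. A' x + B' x)"
    by (rule integral_dominated_convergence[OF _ _ int_G, of _ "\<lambda>n x. A n x + B n x"]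
        integrable_dominated_convergence[OF _ _ int_G, of _ "\<lambda>n x. A n x + B n x"];
        (use tends dom in \<open>auto\<close>))+
  \<comment> \<open>The identity concerns two separate integrals; integrability of
    \<open>A n\<close> and \<open>B n\<close> allows them to be merged.\<close>
  have "(LINT x|lebesgue. A n x + B n x) = - e n" for n
    using identity[of n] A[of n] B[of n] by (simp add: A_def[abs_def] B_def[abs_def])
  then have "(\<lambda>n. LINT x|lebesgue. A n x + B n x) \<longlonglongrightarrow> 0"
    using tendsto_minus[OF e] by simp
  then have zero: "(LINT x|lebesgue. A' x + B' x) = 0"
    using conv LIMSEQ_unique by blast
  have A'_nonneg: "0 \<le> A' x" if "0 \<le> \<rho> x" for x
  proof -
    let ?s = "x \<bullet> x" and ?a = "(norm (v x))\<^sup>2"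
    have s: "?s \<ge> 0" by simp
    \<comment> \<open>For negative \<open>H2\<close>, Cauchy-Schwarz replaces the square of
      \<open>x \<bullet> v x\<close> by its largest possible value, and the radial eigenvalue
      decides the sign.\<close>
    have "0 \<le> 2 * H1 ?s * ?a + 4 * H2 ?s * (x \<bullet> v x)\<^sup>2"
    proof (cases "H2 ?s \<ge> 0")
      case True
      then show ?thesis using pos(1)[OF s] by simp
    next
      case False
      have "0 \<le> 2 * (H1 ?s + 2 * ?s * H2 ?s) * ?a"
        using pos(2)[OF s] by simp
      also have "\<dots> = 2 * H1 ?s * ?a + 4 * H2 ?s * (?s * ?a)" by (simp add: algebra_simps)
      also have "\<dots> \<le> 2 * H1 ?s * ?a + 4 * H2 ?s * (x \<bullet> v x)\<^sup>2"
        using False by (intro add_left_mono mult_left_mono_neg inner_square_le) auto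
      finally show ?thesis .
    qed
    then show ?thesis using that by (simp add: A'_def)
  qed
  \<comment> \<open>Since the dimension is at least 1, the trace is no smaller than the radial
    eigenvalue.\<close>
  have coeff: "0 < 2 * CARD('n) * H1 s + 4 * s * H2 s" if "s \<ge> 0" for s
  proof -
    have "H1 s \<le> CARD('n) * H1 s"
      using pos(1)[OF that] by (simp add: Suc_le_eq)
    with pos(2)[OF that] show ?thesis by simp
  qed
  have "AE x in lebesgue. 0 \<le> A' x + B' x"
    using nonneg
  proof eventually_elim
    case (elim x)
    then show ?case
      using A'_nonneg[of x] coeff[of "x \<bullet> x"] by (simp add: B'_def)
  qed
  with zero int have "AE x in lebesgue. A' x + B' x = 0"
    by (subst (asm) integral_nonneg_eq_0_iff_AE) auto
  with nonneg show ?thesis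
  proof eventually_elim
    case (elim x)
    have "B' x \<le> 0" using A'_nonneg[of x] elim by linarith
    then show ?case
      using elim coeff[of "x \<bullet> x"] by (auto simp: B'_def mult_le_0_iff)
  qed
qed

section \<open>Decay of the viscous term\<close>

text \<open>The Hoelder inequality alone would only bound these integrals uniformly in the radius.
  So \<open>norm (v x)\<close> is split at a threshold depending on \<open>d\<close>: values below
  it cost a multiple of \<open>d ^ (N - 1)\<close> for every radius, the rest tends to 0 by
  dominated convergence for fixed \<open>d\<close>, and \<open>d\<close> is arbitrarily
  small.\<close>

lemma tendsto_integral_ball_average:
  fixes v :: "real^'n \<Rightarrow> real^'n" and b :: "nat \<Rightarrow> real^'n \<Rightarrow> real"
  assumes N: "CARD('n) \<ge> 2"
    and [measurable]: "v \<in> borel_measurable lebesgue" "\<And>n. b n \<in> borel_measurable lebesgue"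
    and int: "integrable lebesgue (\<lambda>x. norm (v x) powr (real CARD('n) / (real CARD('n) - 1)))"
    and b: "\<And>n x. \<bar>b n x\<bar> \<le> C * (norm (v x) / Suc n * indicator (cball 0 (Suc n)) x)"
  shows "(\<lambda>n. LINT x|lebesgue. b n x) \<longlonglongrightarrow> 0"
proof -
  define N where "N = CARD('n)"
  define r where "r = real N / (real N - 1)"
  define V where "V = unit_ball_vol (real N)"
  have N2: "N \<ge> 2" using N by (simp add: N_def)
  have V: "V \<ge> 0" by (simp add: V_def)
  have C': "\<bar>b n x\<bar> \<le> \<bar>C\<bar> * (norm (v x) / Suc n * indicator (cball 0 (Suc n)) x)" for n x
    by (rule order_trans[OF b]) (intro mult_right_mono, auto)
  \<comment> \<open>The first entry of the minimum tends to 0 pointwise in \<open>n\<close>; the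
    second is an integrable bound independent of \<open>n\<close>.\<close>
  define m where "m d n x = min (norm (v x) / Suc n) (norm (v x) powr r / d)" for d n x
  have intr: "integrable lebesgue (\<lambda>x. norm (v x) powr r)"
    using int by (simp add: r_def N_def)
  \<comment> \<open>Compare \<open>a\<close> with $(d/R)^{N-1}$: small values contribute at most $d^{N-1}$ times the unit ball volume
    after integration over the ball of radius \<open>R\<close>, large ones are dominated by \<open>a powr r / d\<close>.\<close>
  have split: "a / R \<le> d ^ (N - 1) / R ^ N + min (a / R) (a powr r / d)"
    if a: "a \<ge> 0" and R: "R > 0" and d: "d > 0" for a R d :: real
  proof (cases "a \<le> (d / R) ^ (N - 1)")
    case True
    have "a / R \<le> (d / R) ^ (N - 1) / R" using True R by (simp add: divide_right_mono)
    also have "\<dots> = d ^ (N - 1) / R ^ N"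
      using N2 by (cases N) (auto simp: power_divide)
    also have "\<dots> \<le> d ^ (N - 1) / R ^ N + min (a / R) (a powr r / d)"
      using that by simp
    finally show ?thesis .
  next
    case False
    then have pos: "0 < a" using R d by (meson a le_less_trans not_le order_less_le zero_le_divide_iff zero_le_power)
    \<comment> \<open>Above the threshold, a root of order \<open>N - 1\<close> gives
      \<open>d / R \<le> a powr (1 / (N - 1))\<close>; multiplying by \<open>a\<close> produces the
      exponent \<open>r = 1 + 1 / (N - 1)\<close>.\<close>
    have "d / R = ((d / R) powr (real N - 1)) powr (1 / (real N - 1))"
      using N2 R d by (simp add: powr_powr)
    also have "(d / R) powr (real N - 1) = (d / R) ^ (N - 1)"
      using N2 R d by (simp add: powr_realpow[symmetric] of_nat_diff)
    also have "((d / R) ^ (N - 1)) powr (1 / (real N - 1)) \<le> a powr (1 / (real N - 1))"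
      using False N2 R d by (intro powr_mono2) auto
    finally have "a * (d / R) \<le> a * a powr (1 / (real N - 1))"
      using a by (intro mult_left_mono)
    also have "\<dots> = a powr r"
    proof -
      have "r = 1 + 1 / (real N - 1)" using N2 by (simp add: r_def field_simps)
      then show ?thesis using pos by (simp add: powr_add)
    qed
    finally have "a / R \<le> a powr r / d" using d R by (simp add: field_simps)
    moreover have "0 \<le> d ^ (N - 1) / R ^ N" using d R by simp
    ultimately show ?thesis by simp
  qed
  have m: "(\<lambda>n. LINT x|lebesgue. m d n x) \<longlonglongrightarrow> (LINT x|(lebesgue :: (real^'n) measure). 0)"
    and int_m: "integrable lebesgue (m d n)" if d: "d > 0" for d n
  proof -
    have *: "integrable lebesgue (\<lambda>x. norm (v x) powr r / d)" using intr by simp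
    have b: "norm (m d n x) \<le> norm (v x) powr r / d" for n x
    proof -
      have "0 \<le> m d n x" using d by (simp add: m_def)
      then show ?thesis by (simp add: m_def)
    qed
    have [measurable]: "m d n \<in> borel_measurable lebesgue" for n
      unfolding m_def by measurable
    show "integrable lebesgue (m d n)"
      by (rule Bochner_Integration.integrable_bound[OF *]) (use b d in \<open>auto intro!: always_eventually\<close>)
    have "(\<lambda>n. m d n x) \<longlonglongrightarrow> 0" for x
    proof (rule tendsto_sandwich)
      show "\<forall>\<^sub>F n in sequentially. 0 \<le> m d n x" using d by (simp add: m_def)
      show "\<forall>\<^sub>F n in sequentially. m d n x \<le> norm (v x) / Suc n" by (simp add: m_def)
      show "(\<lambda>n. norm (v x) / real (Suc n)) \<longlonglongrightarrow> 0"
        by (rule LIMSEQ_Suc) (rule lim_const_over_n)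
    qed auto
    then show "(\<lambda>n. LINT x|lebesgue. m d n x) \<longlonglongrightarrow> (LINT x|(lebesgue :: (real^'n) measure). 0)"
      by (intro integral_dominated_convergence[OF _ _ *]) (use b in auto)
  qed
  \<comment> \<open>The volume of the ball, \<open>V\<close> times the N-th power of its radius,
    cancels the denominator, so the contribution does not depend on \<open>n\<close>.\<close>
  have ball: "integrable lebesgue (\<lambda>x::real^'n. d ^ (N - 1) / real (Suc n) ^ N * indicator (cball 0 (Suc n)) x)"
    "(LINT x|lebesgue. d ^ (N - 1) / real (Suc n) ^ N * indicator (cball 0 (Suc n)) (x::real^'n)) = d ^ (N - 1) * V"
    for d :: real and n
  proof -
    have "emeasure lebesgue (cball (0::real^'n) (Suc n)) < \<infinity>"
      using emeasure_compact_finite[OF compact_cball, of "0::real^'n" "Suc n"] by simp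
    then show "integrable lebesgue (\<lambda>x::real^'n. d ^ (N - 1) / real (Suc n) ^ N * indicator (cball 0 (Suc n)) x)"
      by (intro integrable_mult_right integrable_real_indicator) auto
    have "measure lebesgue (cball (0::real^'n) (Suc n)) = V * real (Suc n) ^ N"
      using content_cball[of "Suc n" "0::real^'n"] by (simp add: V_def N_def)
    then show "(LINT x|lebesgue. d ^ (N - 1) / real (Suc n) ^ N * indicator (cball 0 (Suc n)) (x::real^'n)) = d ^ (N - 1) * V"
      by (simp del: of_nat_Suc)
  qed
  have le: "\<bar>LINT x|lebesgue. b n x\<bar> \<le> \<bar>C\<bar> * (d ^ (N - 1) * V + (LINT x|lebesgue. m d n x))"
    if d: "d > 0" for d n
  proof -
    let ?k = "\<lambda>x. \<bar>C\<bar> * (d ^ (N - 1) / real (Suc n) ^ N * indicator (cball 0 (Suc n)) x + m d n x)"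
    have k: "integrable lebesgue ?k"
      by (rule integrable_mult_right) (rule Bochner_Integration.integrable_add[OF ball(1) int_m[OF d]])
    have bk: "\<bar>b n x\<bar> \<le> ?k x" for x
    proof -
      have "norm (v x) / Suc n * indicator (cball 0 (Suc n)) x
          \<le> d ^ (N - 1) / real (Suc n) ^ N * indicator (cball 0 (Suc n)) x + m d n x"
        using split[of "norm (v x)" "real (Suc n)" d] d by (auto simp: m_def indicator_def)
      then have "\<bar>C\<bar> * (norm (v x) / Suc n * indicator (cball 0 (Suc n)) x) \<le> ?k x"
        by (rule mult_left_mono) simp
      with C'[of n x] show ?thesis by linarith
    qed
    have bi: "integrable lebesgue (b n)"
    proof (rule Bochner_Integration.integrable_bound[OF k])
      show "AE x in lebesgue. norm (b n x) \<le> norm (?k x)"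
        unfolding real_norm_def by (intro always_eventually allI order_trans[OF bk abs_ge_self])
    qed measurable
    have "\<bar>LINT x|lebesgue. b n x\<bar> \<le> (LINT x|lebesgue. \<bar>b n x\<bar>)"
      by (rule integral_abs_bound)
    also have "\<dots> \<le> (LINT x|lebesgue. ?k x)"
      by (rule integral_mono) (use bi k bk in auto)
    also have "\<dots> = \<bar>C\<bar> * (d ^ (N - 1) * V + (LINT x|lebesgue. m d n x))"
      by (subst integral_mult_right_zero)
        (simp only: Bochner_Integration.integral_add[OF ball(1) int_m[OF d]] ball(2))
    finally show ?thesis .
  qed
  show ?thesis
  proof (rule LIMSEQ_I)
    fix \<epsilon> :: real assume \<epsilon>: "\<epsilon> > 0"
    \<comment> \<open>The bound 1 gives \<open>d ^ (N - 1) \<le> d\<close>, as N is at least 2. The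
      other bound makes the uniform part at most \<open>\<epsilon> / 2\<close>; the added 1 keeps
      its denominator positive even if \<open>\<bar>C\<bar> * V\<close> is zero.\<close>
    define d where "d = min 1 (\<epsilon> / (2 * (\<bar>C\<bar> * V + 1)))"
    have CV: "\<bar>C\<bar> * V + 1 > 0" using V by (simp add: add_nonneg_pos)
    have d: "d > 0" "d \<le> 1" using \<epsilon> CV by (auto simp: d_def)
    have "d ^ (N - 1) \<le> d ^ 1" using d N2 by (intro power_decreasing) auto
    then have "\<bar>C\<bar> * (d ^ (N - 1) * V) \<le> \<bar>C\<bar> * (d * V)"
      using V by (intro mult_left_mono mult_right_mono) auto
    also have "\<dots> \<le> d * (\<bar>C\<bar> * V + 1)" using d by (simp add: algebra_simps)
    also have "\<dots> \<le> \<epsilon> / (2 * (\<bar>C\<bar> * V + 1)) * (\<bar>C\<bar> * V + 1)"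
      using CV by (intro mult_right_mono) (auto simp: d_def)
    also have "\<dots> = \<epsilon> / 2" using CV by (simp add: field_simps)
    finally have 1: "\<bar>C\<bar> * (d ^ (N - 1) * V) \<le> \<epsilon> / 2" .
    have "(\<lambda>n. \<bar>C\<bar> * (LINT x|lebesgue. m d n x)) \<longlonglongrightarrow> \<bar>C\<bar> * (LINT x|(lebesgue :: (real^'n) measure). 0)"
      by (intro tendsto_intros m d)
    then have "\<forall>\<^sub>F n in sequentially. \<bar>C\<bar> * (LINT x|lebesgue. m d n x) < \<epsilon> / 2"
      using \<epsilon> by (intro order_tendstoD(2)) auto
    then obtain n0 where n0: "\<And>n. n \<ge> n0 \<Longrightarrow> \<bar>C\<bar> * (LINT x|lebesgue. m d n x) < \<epsilon> / 2"
      by (auto simp: eventually_sequentially)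
    show "\<exists>no. \<forall>n\<ge>no. norm ((LINT x|lebesgue. b n x) - 0) < \<epsilon>"
    proof (intro exI allI impI)
      fix n assume "n0 \<le> n"
      from n0[OF this] le[OF d(1), of n] 1
      show "norm ((LINT x|lebesgue. b n x) - 0) < \<epsilon>" by (simp add: distrib_left)
    qed
  qed
qed

section \<open>Radial test functions and basic properties of solutions\<close>

lemma test_function_radial:
  assumes "\<And>k. Ck k (\<lambda>x::real^'n. h (x \<bullet> x) :: real)" and "\<And>s. s \<ge> M \<Longrightarrow> h s = 0"
  shows "test_function (\<lambda>x::real^'n. h (x \<bullet> x))"
proof -
  have "{x::real^'n. h (x \<bullet> x) \<noteq> 0} \<subseteq> cball 0 (sqrt M)"
    using assms(2) by (auto simp: norm_eq_sqrt_inner not_le[symmetric] intro!: real_sqrt_le_mono)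
      (metis linear)
  then have "bounded {x::real^'n. h (x \<bullet> x) \<noteq> 0}"
    by (rule bounded_subset[OF bounded_cball])
  then show ?thesis using assms(1) by (simp add: test_function_def)
qed

text \<open>The pressure law fixes signs only at nonnegative densities, which is why the claim is an
  almost everywhere statement.\<close>

lemma stationary_weak_solution_pressure_nonneg:
  assumes "pressure_law p" "stationary_weak_solution p mu lam f \<rho> v S"
  shows "AE x in lebesgue. 0 \<le> p (\<rho> x, S x)"
  using assms unfolding pressure_law_def stationary_weak_solution_def by auto

lemma stationary_weak_solution_measurable:
  assumes "stationary_weak_solution p mu lam f \<rho> v S"
  shows "v \<in> borel_measurable lebesgue" "\<rho> \<in> borel_measurable lebesgue"
    "(\<lambda>x. p (\<rho> x, S x)) \<in> borel_measurable lebesgue" "AE x in lebesgue. 0 \<le> \<rho> x"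
  using assms unfolding stationary_weak_solution_def L1_loc_def L2_loc_def Linf_loc_def by auto

section \<open>The case where 2 mu + lam is zero\<close>

text \<open>The limit potential grows linearly, so its Hessian decays like
  \<open>1 / (1 + norm x)\<close>, which is exactly the weight in \<open>int\<close>.\<close>

lemma pressure_vanishes_trace_free:
  fixes f v :: "real^'n \<Rightarrow> real^'n" and \<rho> S :: "real^'n \<Rightarrow> real"
  assumes p: "pressure_law p" and f: "weakly_divergence_free f"
    and sol: "stationary_weak_solution p mu lam f \<rho> v S"
    and visc: "2 * mu + lam = 0"
    and int: "integrable lebesgue (\<lambda>x. (\<rho> x * (norm (v x))\<^sup>2 + p (\<rho> x, S x)) / (1 + norm x))"
  shows "AE x in lebesgue. p (\<rho> x, S x) = 0"
proof -
  define u where "u n s = 1 - sqrt (1 + s) / Suc n" for n s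
  \<comment> \<open>As \<open>flat_exp 0 (1 - t)\<close> is \<open>- g t\<close>, this is
    \<open>R * g (sqrt (1 + s) / R)\<close> with \<open>R = Suc n\<close>; \<open>h1\<close> and
    \<open>h2\<close> are its first two derivatives in \<open>s\<close>.\<close>
  define h0 where "h0 n s = - real (Suc n) * flat_exp 0 (u n s)" for n s
  define h1 where "h1 n s = flat_exp 2 (u n s) / (2 * sqrt (1 + s))" for n s
  define h2 where "h2 n s = - (flat_exp 4 (u n s) - 2 * flat_exp 3 (u n s)) / (4 * real (Suc n) * (1 + s))
      - flat_exp 2 (u n s) / (4 * sqrt (1 + s) * (1 + s))" for n s
  note d = DERIV_chain2[OF has_real_derivative_flat_exp]
  have du: "(u n has_real_derivative - 1 / (2 * real (Suc n) * sqrt (1 + s))) (at s)" if "s \<ge> 0" for n s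
    unfolding u_def[abs_def] using that
    by (auto intro!: derivative_eq_intros simp: field_simps simp del: of_nat_Suc)
  have D0: "(h0 n has_real_derivative h1 n s) (at s)" if "s \<ge> 0" for n s
    unfolding h0_def[abs_def] h1_def
    by (rule derivative_eq_intros d du that refl)+ (simp add: field_simps numeral_2_eq_2 del: of_nat_Suc)
  have sqrt_deriv: "((\<lambda>s. sqrt (1 + s)) has_real_derivative 1 / (2 * sqrt (1 + s))) (at s)"
    if "s \<ge> 0" for s
    using that by (auto intro!: derivative_eq_intros simp: field_simps)
  have D1: "(h1 n has_real_derivative h2 n s) (at s)" if "s \<ge> 0" for n s
  proof -
    define t where "t = sqrt (1 + s)"
    have t: "t > 0" "1 + s = t\<^sup>2" using that by (auto simp: t_def)
    note sq = sqrt_deriv[OF that, folded t_def]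
    have R: "real (Suc n) > 0" by simp
    show ?thesis
      unfolding h1_def[abs_def] h2_def
    proof (rule DERIV_cong, rule DERIV_divide, rule d, rule du[OF that], rule DERIV_cmult, rule sq)
      show "((flat_exp (2 + 2) (u n s) - real 2 * flat_exp (2 + 1) (u n s)) *
            (- 1 / (2 * real (Suc n) * sqrt (1 + s))) * (2 * sqrt (1 + s)) -
          flat_exp 2 (u n s) * (2 * (1 / (2 * t)))) / (2 * sqrt (1 + s) * (2 * sqrt (1 + s))) =
        - (flat_exp 4 (u n s) - 2 * flat_exp 3 (u n s)) / (4 * real (Suc n) * (1 + s)) -
          flat_exp 2 (u n s) / (4 * sqrt (1 + s) * (1 + s))"
        using t R unfolding t_def[symmetric] t(2)
        by (simp add: field_simps power2_eq_square eval_nat_numeral del: of_nat_Suc)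
    qed (use that in auto)
  qed
  \<comment> \<open>With \<open>2 * mu + lam = 0\<close> the third derivative enters only multiplied
    by zero, so its existence suffices and \<open>deriv\<close> stands for it.\<close>
  have D2: "(h2 n has_real_derivative deriv (h2 n) s) (at s)" if "s \<ge> 0" for n s
  proof -
    have F: "(\<lambda>s. flat_exp m (u n s)) field_differentiable at s" for m
      unfolding field_differentiable_def using d[OF du[OF that]] by blast
    have sq: "(\<lambda>s. sqrt (1 + s)) field_differentiable at s"
      unfolding field_differentiable_def using sqrt_deriv[OF that] by blast
    have "h2 n field_differentiable at s"
      unfolding h2_def[abs_def] using that
      by (intro field_differentiable_diff field_differentiable_divide field_differentiable_minus
          field_differentiable_mult field_differentiable_add field_differentiable_const
          field_differentiable_ident F sq) auto
    then have "\<exists>D. (h2 n has_real_derivative D) (at s)" by (simp add: field_differentiable_def)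
    then show ?thesis by (metis DERIV_imp_deriv)
  qed
  obtain c2 c3 c4 where c: "\<And>s. s \<le> 1 \<Longrightarrow> \<bar>flat_exp 2 s\<bar> \<le> c2"
      "\<And>s. s \<le> 1 \<Longrightarrow> \<bar>flat_exp 3 s\<bar> \<le> c3" "\<And>s. s \<le> 1 \<Longrightarrow> \<bar>flat_exp 4 s\<bar> \<le> c4"
    using flat_exp_bounded by metis
  have c_nonneg: "0 \<le> c2" "0 \<le> c3" "0 \<le> c4"
    using c[of 0] by (auto simp: flat_exp_nonpos)
  have u_le: "u n s \<le> 1" if "s \<ge> 0" for n s
    using that by (simp add: u_def)
  \<comment> \<open>Exchanges the smooth weight \<open>1 / sqrt (1 + s)\<close> for the weight of
    the assumption, which is \<open>1 / (1 + sqrt s)\<close> at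
    \<open>s = x \<bullet> x\<close>.\<close>
  have sqrt_le: "1 + sqrt s \<le> 2 * sqrt (1 + s)" if "s \<ge> 0" for s
  proof -
    have "1 \<le> sqrt (1 + s)" "sqrt s \<le> sqrt (1 + s)" using that by auto
    then show ?thesis by linarith
  qed
  have inv_le: "K / (2 * sqrt (1 + s)) \<le> K * (1 / (1 + sqrt s))" if "s \<ge> 0" "K \<ge> 0" for s K
    using sqrt_le[OF that(1)] that
    by (simp, intro divide_left_mono mult_pos_pos) (auto intro: add_pos_nonneg)
  show ?thesis
  proof (rule pressure_vanishes)
    show "v \<in> borel_measurable lebesgue" "\<rho> \<in> borel_measurable lebesgue"
      "(\<lambda>x. p (\<rho> x, S x)) \<in> borel_measurable lebesgue" "AE x in lebesgue. 0 \<le> \<rho> x"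
      by (fact stationary_weak_solution_measurable[OF sol])+
    show "AE x in lebesgue. 0 \<le> p (\<rho> x, S x)"
      by (rule stationary_weak_solution_pressure_nonneg[OF p sol])
    show "integrable lebesgue (\<lambda>x. (\<rho> x * (norm (v x))\<^sup>2 + p (\<rho> x, S x)) * (1 / (1 + sqrt (x \<bullet> x))))"
      using int by (simp add: norm_eq_sqrt_inner)
    show "0 \<le> 1 / (1 + sqrt s)" if "s \<ge> 0" for s using that by simp
    show "continuous_on {0..} (h1 n)" for n
      by (intro continuous_at_imp_continuous_on ballI DERIV_isCont[OF D1]) auto
    show "continuous_on {0..} (h2 n)" for n
      by (intro continuous_at_imp_continuous_on ballI DERIV_isCont[OF D2]) auto
    fix n :: nat
    show "\<bar>h1 n s\<bar> \<le> (c2 + 2 * c3 + c4) * (1 / (1 + sqrt s))" if "s \<ge> 0" for s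
    proof -
      have "\<bar>h1 n s\<bar> \<le> (c2 + 2 * c3 + c4) / (2 * sqrt (1 + s))"
        using c(1)[OF u_le[OF that], of n] c_nonneg that unfolding h1_def
        by (auto simp: abs_mult intro!: divide_right_mono)
      then show ?thesis using inv_le[OF that, of "c2 + 2 * c3 + c4"] c_nonneg by linarith
    qed
    show "s * \<bar>h2 n s\<bar> \<le> (c2 + 2 * c3 + c4) * (1 / (1 + sqrt s))" if s: "s \<ge> 0" for s
    proof (cases "u n s \<le> 0")
      case True
      then show ?thesis using s c_nonneg by (simp add: h2_def flat_exp_nonpos)
    next
      case False
      define t where "t = sqrt (1 + s)"
      have t: "t > 0" "1 + s = t\<^sup>2" using s by (auto simp: t_def)
      \<comment> \<open>Where the profile is not zero, \<open>t \<le> R\<close>, so the factor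
        \<open>1 / R\<close> in \<open>h2\<close> may be replaced by \<open>1 / t\<close>; this
        makes the decay uniform in \<open>n\<close>.\<close>
      have tR: "t \<le> real (Suc n)"
        using False by (simp add: u_def t_def divide_simps split: if_splits)
      have "\<bar>(flat_exp 4 (u n s) - 2 * flat_exp 3 (u n s)) / (4 * real (Suc n) * (1 + s))\<bar>
          \<le> (2 * c3 + c4) / (4 * t * t\<^sup>2)"
        unfolding abs_divide
        using c(2)[OF u_le[OF s], of n] c(3)[OF u_le[OF s], of n] t tR c_nonneg
        by (intro frac_le) (auto intro!: mult_right_mono simp del: of_nat_Suc)
      moreover have "\<bar>flat_exp 2 (u n s) / (4 * sqrt (1 + s) * (1 + s))\<bar> \<le> c2 / (4 * t * t\<^sup>2)"
        unfolding abs_divide t_def[symmetric]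
        using c(1)[OF u_le[OF s], of n] t c_nonneg
        by (intro frac_le) auto
      ultimately have "\<bar>h2 n s\<bar> \<le> (2 * c3 + c4) / (4 * t * t\<^sup>2) + c2 / (4 * t * t\<^sup>2)"
        unfolding h2_def by linarith
      also have "\<dots> = (c2 + 2 * c3 + c4) / (4 * t * t\<^sup>2)"
        by (simp add: add_divide_distrib)
      finally have "s * \<bar>h2 n s\<bar> \<le> t\<^sup>2 * ((c2 + 2 * c3 + c4) / (4 * t * t\<^sup>2))"
        using s t by (intro mult_mono) auto
      also have "\<dots> = ((c2 + 2 * c3 + c4) / 2) / (2 * sqrt (1 + s))"
        using t(1) by (simp add: t_def[symmetric])
      also have "\<dots> \<le> (c2 + 2 * c3 + c4) / (2 * sqrt (1 + s))"
        using c_nonneg s by (intro divide_right_mono) auto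
      finally show ?thesis using inv_le[OF s, of "c2 + 2 * c3 + c4"] c_nonneg by linarith
    qed
    have test: "test_function (\<lambda>x::real^'n. h0 n (x \<bullet> x))"
    proof (rule test_function_radial)
      show "h0 n s = 0" if "s \<ge> (real (Suc n))\<^sup>2" for s
      proof -
        have "real (Suc n) \<le> sqrt (1 + s)"
          using that by (intro real_le_rsqrt) simp
        then show ?thesis
          by (simp add: h0_def u_def flat_exp_nonpos del: of_nat_Suc)
      qed
      \<comment> \<open>The root is rewritten as a power and the difference as a sum with a negative
        coefficient, to fit the closure rules for \<open>Ck\<close>.\<close>
      have "h0 n (x \<bullet> x) = - real (Suc n) *
          flat_exp 0 (1 + (- 1 / Suc n) * (1 + x \<bullet> x) powr (1/2))" for x :: "real^'n"
        by (simp add: h0_def u_def powr_half_sqrt)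
      then show "Ck k (\<lambda>x::real^'n. h0 n (x \<bullet> x))" for k
        by (simp only:) (intro Ck_mult Ck_add Ck_const Ck_flat_exp Ck_powr Ck_inner_self,
            auto intro: add_pos_nonneg)
    qed
    show "(LINT x|lebesgue. \<rho> x * (2 * h1 n (x \<bullet> x) * (norm (v x))\<^sup>2 +
        4 * h2 n (x \<bullet> x) * (x \<bullet> v x)\<^sup>2)) =
      - (LINT x|lebesgue. p (\<rho> x, S x) * (2 * CARD('n) * h1 n (x \<bullet> x) + 4 * (x \<bullet> x) * h2 n (x \<bullet> x))) - 0"
      using momentum_radial[OF D0 D1 D2 sol f test] by (simp add: visc)
  next
    fix s :: real assume s: "s \<ge> 0"
    have "(\<lambda>n. sqrt (1 + s) / real (Suc n)) \<longlonglongrightarrow> 0"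
      by (rule LIMSEQ_Suc) (rule lim_const_over_n)
    from tendsto_diff[OF tendsto_const this] have "(\<lambda>n. u n s) \<longlonglongrightarrow> 1" by (simp add: u_def)
    then have F: "(\<lambda>n. flat_exp m (u n s)) \<longlonglongrightarrow> flat_exp m 1" for m
      by (rule isCont_tendsto_compose[OF DERIV_isCont[OF has_real_derivative_flat_exp]])
    \<comment> \<open>The two limits are the first and second derivative in \<open>s\<close> of
      \<open>flat_exp 2 1 * sqrt (1 + s)\<close>, where \<open>flat_exp 2 1\<close> is the slope of
      \<open>g\<close> at 0.\<close>
    show "(\<lambda>n. h1 n s) \<longlonglongrightarrow> flat_exp 2 1 / (2 * sqrt (1 + s))"
      unfolding h1_def using s by (intro tendsto_intros F) auto
    have h2_eq: "h2 n s = - (flat_exp 4 (u n s) - 2 * flat_exp 3 (u n s)) / (4 * (1 + s)) * (1 / Suc n)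
        - flat_exp 2 (u n s) / (4 * sqrt (1 + s) * (1 + s))" for n
      using s by (simp add: h2_def mult_ac del: of_nat_Suc)
    have "(\<lambda>n. - (flat_exp 4 (u n s) - 2 * flat_exp 3 (u n s)) / (4 * (1 + s)) * (1 / Suc n)
        - flat_exp 2 (u n s) / (4 * sqrt (1 + s) * (1 + s)))
      \<longlonglongrightarrow> - (flat_exp 4 1 - 2 * flat_exp 3 1) / (4 * (1 + s)) * 0
        - flat_exp 2 1 / (4 * sqrt (1 + s) * (1 + s))"
      using s by (intro tendsto_intros F LIMSEQ_Suc[OF lim_1_over_n]) auto
    then show "(\<lambda>n. h2 n s) \<longlonglongrightarrow> - flat_exp 2 1 / (4 * sqrt (1 + s) * (1 + s))"
      by (simp add: h2_eq)
    have F2: "flat_exp 2 1 > 0" by (simp add: flat_exp_def)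
    then show "0 < flat_exp 2 1 / (2 * sqrt (1 + s))" using s by simp
    \<comment> \<open>Half the radial eigenvalue of the limit. It decays faster than the weight, but
      only its sign matters.\<close>
    have "flat_exp 2 1 / (2 * sqrt (1 + s)) + 2 * s * (- flat_exp 2 1 / (4 * sqrt (1 + s) * (1 + s))) =
        flat_exp 2 1 / (2 * sqrt (1 + s) * (1 + s))"
    proof -
      define t where "t = sqrt (1 + s)"
      have t: "t > 0" "1 + s = t\<^sup>2" "s = t\<^sup>2 - 1" using s by (auto simp: t_def)
      show ?thesis
        unfolding t_def[symmetric] t(2) unfolding t(3)
        using t(1) by (simp add: field_simps)
    qed
    also have "\<dots> > 0" using F2 s by (intro divide_pos_pos mult_pos_pos) auto
    finally show "0 < flat_exp 2 1 / (2 * sqrt (1 + s)) +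
        2 * s * (- flat_exp 2 1 / (4 * sqrt (1 + s) * (1 + s)))" .
  qed (auto intro: tendsto_const)
qed

section \<open>The viscous case with an integrable power of the velocity\<close>

text \<open>A potential that is quadratic in \<open>x\<close> near the origin has a bounded Hessian,
  so the weight is 1. Cutting it off at radius \<open>R\<close> costs third derivatives of size
  \<open>1 / R\<close> only, which makes the viscous term small.\<close>

lemma pressure_vanishes_viscous:
  fixes f v :: "real^'n \<Rightarrow> real^'n" and \<rho> S :: "real^'n \<Rightarrow> real"
  assumes p: "pressure_law p" and f: "weakly_divergence_free f"
    and sol: "stationary_weak_solution p mu lam f \<rho> v S"
    and N: "CARD('n) \<ge> 2"
    and int: "integrable lebesgue (\<lambda>x. \<rho> x * (norm (v x))\<^sup>2 + p (\<rho> x, S x))"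
    and int_v: "integrable lebesgue (\<lambda>x. norm (v x) powr (real CARD('n) / (real CARD('n) - 1)))"
  shows "AE x in lebesgue. p (\<rho> x, S x) = 0"
proof -
  define R where "R n = real (Suc n)" for n
  have R: "R n > 0" for n by (simp add: R_def)
  define u where "u n s = 1 - s / (R n)\<^sup>2" for n s
  define h0 where "h0 n s = - (R n)\<^sup>2 * flat_exp 0 (u n s)" for n s
  define h1 where "h1 n s = flat_exp 2 (u n s)" for n s
  define h2 where "h2 n s = - (flat_exp 4 (u n s) - 2 * flat_exp 3 (u n s)) / (R n)\<^sup>2" for n s
  \<comment> \<open>The coefficients come from the derivatives of \<open>flat_exp 4\<close> and
    \<open>- 2 * flat_exp 3\<close>: index 5 collects \<open>- 4 - 2\<close>, index 4 collects
    \<open>2 * 3\<close>.\<close>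
  define h3 where "h3 n s = (flat_exp 6 (u n s) - 6 * flat_exp 5 (u n s) + 6 * flat_exp 4 (u n s))
      / ((R n)\<^sup>2 * (R n)\<^sup>2)" for n s
  note d = DERIV_chain2[OF has_real_derivative_flat_exp]
  have du: "(u n has_real_derivative - 1 / (R n)\<^sup>2) (at s)" for n s
  proof -
    obtain Q where Q: "Q = (R n)\<^sup>2" "Q > 0" using R[of n] by simp
    show ?thesis
      unfolding u_def[abs_def] Q(1)[symmetric] using Q(2)
      by (auto intro!: derivative_eq_intros simp: field_simps)
  qed
  have D0: "(h0 n has_real_derivative h1 n s) (at s)" for n s
    unfolding h0_def[abs_def] h1_def
    by ((rule derivative_eq_intros d du refl)+) (use R[of n] in \<open>simp add: numeral_2_eq_2\<close>)
  have D1: "(h1 n has_real_derivative h2 n s) (at s)" for n s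
    unfolding h1_def[abs_def] h2_def
    by (rule DERIV_cong, rule d, rule du) (simp add: eval_nat_numeral diff_divide_distrib)
  have D2: "(h2 n has_real_derivative h3 n s) (at s)" for n s
  proof -
    obtain Q where Q: "Q = (R n)\<^sup>2" "Q > 0" using R[of n] by simp
    show ?thesis
      unfolding h2_def[abs_def] h3_def Q(1)[symmetric]
      by ((rule derivative_eq_intros d du[of n, folded Q(1)] refl)+)
        (use Q(2) in \<open>simp_all add: field_simps eval_nat_numeral\<close>)
  qed
  obtain c2 c3 c4 c5 c6 where c: "\<And>s. s \<le> 1 \<Longrightarrow> \<bar>flat_exp 2 s\<bar> \<le> c2"
      "\<And>s. s \<le> 1 \<Longrightarrow> \<bar>flat_exp 3 s\<bar> \<le> c3" "\<And>s. s \<le> 1 \<Longrightarrow> \<bar>flat_exp 4 s\<bar> \<le> c4"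
      "\<And>s. s \<le> 1 \<Longrightarrow> \<bar>flat_exp 5 s\<bar> \<le> c5" "\<And>s. s \<le> 1 \<Longrightarrow> \<bar>flat_exp 6 s\<bar> \<le> c6"
    using flat_exp_bounded by metis
  have c_nonneg: "0 \<le> c2" "0 \<le> c3" "0 \<le> c4" "0 \<le> c5" "0 \<le> c6"
    using c[of 0] by (auto simp: flat_exp_nonpos)
  have u_le: "u n s \<le> 1" if "s \<ge> 0" for n s
    using that by (simp add: u_def)
  \<comment> \<open>Where the profile is not zero, each factor \<open>s\<close> can be traded for
    the square of \<open>R n\<close>.\<close>
  have u_pos: "s \<le> (R n)\<^sup>2" if "\<not> u n s \<le> 0" for n s
    using that R[of n] by (simp add: u_def divide_simps split: if_splits)
  have h2_le: "\<bar>h2 n s\<bar> \<le> (2 * c3 + c4) / (R n)\<^sup>2" if "s \<ge> 0" for n s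
    using c(2)[OF u_le[OF that], of n] c(3)[OF u_le[OF that], of n]
    unfolding h2_def abs_divide by (simp add: divide_right_mono)
  have h3_le: "s * \<bar>h3 n s\<bar> \<le> (c6 + 6 * c5 + 6 * c4) / (R n)\<^sup>2" if "s \<ge> 0" for n s
  proof (cases "u n s \<le> 0")
    case True
    then show ?thesis using c_nonneg by (simp add: h3_def flat_exp_nonpos)
  next
    case False
    have "\<bar>h3 n s\<bar> \<le> (c6 + 6 * c5 + 6 * c4) / ((R n)\<^sup>2 * (R n)\<^sup>2)"
      using c(3-5)[OF u_le[OF that], of n]
      unfolding h3_def abs_divide by (simp add: divide_right_mono)
    then have "s * \<bar>h3 n s\<bar> \<le> (R n)\<^sup>2 * ((c6 + 6 * c5 + 6 * c4) / ((R n)\<^sup>2 * (R n)\<^sup>2))"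
      using u_pos[OF False] that by (intro mult_mono) auto
    also have "\<dots> = (c6 + 6 * c5 + 6 * c4) / (R n)\<^sup>2"
      unfolding times_divide_eq_right
      using R[of n] by (intro nonzero_mult_divide_mult_cancel_left) simp
    finally show ?thesis .
  qed
  \<comment> \<open>At \<open>s = x \<bullet> x\<close> this is the scalar that multiplies
    \<open>x\<close> in the gradient of the Laplacian of the potential.\<close>
  define K where "K n s = 4 * (CARD('n) + 2) * h2 n s + 8 * s * h3 n s" for n s
  define K0 where "K0 = 4 * (CARD('n) + 2) * (2 * c3 + c4) + 8 * (c6 + 6 * c5 + 6 * c4)"
  have K_le: "\<bar>K n s\<bar> \<le> K0 / (R n)\<^sup>2" if "s \<ge> 0" for n s
  proof -
    have "\<bar>K n s\<bar> \<le> 4 * (CARD('n) + 2) * \<bar>h2 n s\<bar> + 8 * (s * \<bar>h3 n s\<bar>)"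
      using that unfolding K_def by (intro order_trans[OF abs_triangle_ineq]) (simp add: abs_mult)
    also have "\<dots> \<le> 4 * (CARD('n) + 2) * ((2 * c3 + c4) / (R n)\<^sup>2) + 8 * ((c6 + 6 * c5 + 6 * c4) / (R n)\<^sup>2)"
      by (intro add_mono mult_left_mono h2_le h3_le that) auto
    also have "\<dots> = K0 / (R n)\<^sup>2" by (simp add: K0_def add_divide_distrib distrib_left)
    finally show ?thesis .
  qed
  note meas = stationary_weak_solution_measurable[OF sol]
  have cont: "continuous_on {0..} (K n)" for n
  proof -
    have F: "continuous_on {0..} (\<lambda>s. flat_exp m (u n s))" for m
      using R[of n] unfolding u_def
      by (intro continuous_on_compose2[OF continuous_on_flat_exp[of UNIV]] continuous_intros) auto
    show ?thesis
      using R[of n] unfolding K_def h2_def h3_def by (intro continuous_intros F) auto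
  qed
  \<comment> \<open>Inside the ball, \<open>norm x \<le> R n\<close> leaves a factor
    \<open>K0 / R n\<close> in front of \<open>norm (v x)\<close>; outside it \<open>K\<close>
    vanishes.\<close>
  have lim: "(\<lambda>n. LINT x|lebesgue. K n (x \<bullet> x) * (x \<bullet> v x)) \<longlonglongrightarrow> 0"
  proof (rule tendsto_integral_ball_average[OF N meas(1) _ int_v])
    have id: "(\<lambda>x::real^'n. x) \<in> borel_measurable lebesgue"
      by (intro measurable_completion) simp
    show "(\<lambda>x. K n (x \<bullet> x) * (x \<bullet> v x)) \<in> borel_measurable lebesgue" for n
      by (intro borel_measurable_times borel_measurable_radial cont borel_measurable_inner id meas)
    show "\<bar>K n (x \<bullet> x) * (x \<bullet> v x)\<bar> \<le> K0 * (norm (v x) / Suc n * indicator (cball 0 (Suc n)) x)" for n x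
    proof (cases "u n (x \<bullet> x) \<le> 0")
      case True
      then have "K n (x \<bullet> x) = 0" by (simp add: K_def h2_def h3_def flat_exp_nonpos)
      then show ?thesis using c_nonneg by (simp add: K0_def)
    next
      case False
      have x: "norm x \<le> R n"
        using u_pos[OF False] R[of n] by (simp add: norm_eq_sqrt_inner real_le_lsqrt)
      have "\<bar>K n (x \<bullet> x) * (x \<bullet> v x)\<bar> \<le> (K0 / (R n)\<^sup>2) * (norm x * norm (v x))"
        unfolding abs_mult using K_le[of "x \<bullet> x" n]
        by (intro mult_mono Cauchy_Schwarz_ineq2) auto
      also have "\<dots> \<le> (K0 / (R n)\<^sup>2) * (R n * norm (v x))"
        using x c_nonneg by (intro mult_left_mono mult_right_mono) (auto simp: K0_def)
      also have "\<dots> = K0 * (norm (v x) / R n)" using R[of n] by (simp add: power2_eq_square)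
      finally show ?thesis using x by (simp add: R_def)
    qed
  qed
  have s_R: "(\<lambda>n. s / (R n)\<^sup>2) \<longlonglongrightarrow> 0" for s
  proof -
    have "(\<lambda>n. s * (1 / real (Suc n))\<^sup>2) \<longlonglongrightarrow> s * 0\<^sup>2"
      by (intro tendsto_intros LIMSEQ_Suc[OF lim_1_over_n])
    then show ?thesis by (simp add: R_def power_divide)
  qed
  show ?thesis
  \<comment> \<open>The limit potential is affine in \<open>s\<close>, so \<open>H2\<close> is zero
    and the limit Hessian is a positive constant times the identity.\<close>
  proof (rule pressure_vanishes[where w = "\<lambda>_. 1" and ?h1.0 = h1 and ?h2.0 = h2
        and C = "c2 + 2 * c3 + c4" and ?H1.0 = "\<lambda>_. flat_exp 2 1" and ?H2.0 = "\<lambda>_. 0"])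
    show "v \<in> borel_measurable lebesgue" "\<rho> \<in> borel_measurable lebesgue"
      "(\<lambda>x. p (\<rho> x, S x)) \<in> borel_measurable lebesgue" "AE x in lebesgue. 0 \<le> \<rho> x"
      by (fact meas)+
    show "AE x in lebesgue. 0 \<le> p (\<rho> x, S x)"
      by (rule stationary_weak_solution_pressure_nonneg[OF p sol])
    show "integrable lebesgue (\<lambda>x. (\<rho> x * (norm (v x))\<^sup>2 + p (\<rho> x, S x)) * 1)"
      using int by simp
    show "(0::real) \<le> 1" by simp
    show "(\<lambda>n. (2 * mu + lam) * (LINT x|lebesgue. K n (x \<bullet> x) * (x \<bullet> v x))) \<longlonglongrightarrow> 0"
      using tendsto_mult_left[OF lim] by simp
    fix n :: nat
    show "continuous_on {0..} (h1 n)"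
      by (intro continuous_at_imp_continuous_on ballI DERIV_isCont[OF D1])
    show "continuous_on {0..} (h2 n)"
      by (intro continuous_at_imp_continuous_on ballI DERIV_isCont[OF D2])
    show "\<bar>h1 n s\<bar> \<le> (c2 + 2 * c3 + c4) * 1" if "s \<ge> 0" for s
      using c(1)[OF u_le[OF that], of n] c_nonneg by (simp add: h1_def)
    show "s * \<bar>h2 n s\<bar> \<le> (c2 + 2 * c3 + c4) * 1" if s: "s \<ge> 0" for s
    proof (cases "u n s \<le> 0")
      case True
      then show ?thesis using c_nonneg by (simp add: h2_def flat_exp_nonpos)
    next
      case False
      have "s * \<bar>h2 n s\<bar> \<le> (R n)\<^sup>2 * ((2 * c3 + c4) / (R n)\<^sup>2)"
        using u_pos[OF False] h2_le[OF s] s by (intro mult_mono) auto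
      also have "\<dots> \<le> c2 + 2 * c3 + c4" using R[of n] c_nonneg by simp
      finally show ?thesis by simp
    qed
    have test: "test_function (\<lambda>x::real^'n. h0 n (x \<bullet> x))"
    proof (rule test_function_radial)
      show "h0 n s = 0" if "s \<ge> (R n)\<^sup>2" for s
        using that R[of n] by (simp add: h0_def u_def flat_exp_nonpos)
      have "h0 n (x \<bullet> x) = - (R n)\<^sup>2 * flat_exp 0 (1 + (- 1 / (R n)\<^sup>2) * (x \<bullet> x))" for x :: "real^'n"
        by (simp add: h0_def u_def)
      then show "Ck k (\<lambda>x::real^'n. h0 n (x \<bullet> x))" for k
        by (simp only:) (intro Ck_mult Ck_add Ck_const Ck_flat_exp Ck_inner_self)
    qed
    show "(LINT x|lebesgue. \<rho> x * (2 * h1 n (x \<bullet> x) * (norm (v x))\<^sup>2 +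
        4 * h2 n (x \<bullet> x) * (x \<bullet> v x)\<^sup>2)) =
      - (LINT x|lebesgue. p (\<rho> x, S x) * (2 * CARD('n) * h1 n (x \<bullet> x) + 4 * (x \<bullet> x) * h2 n (x \<bullet> x)))
      - (2 * mu + lam) * (LINT x|lebesgue. K n (x \<bullet> x) * (x \<bullet> v x))"
      using momentum_radial[OF D0 D1 D2 sol f test] by (simp add: K_def)
  next
    fix s :: real assume s: "s \<ge> 0"
    from tendsto_diff[OF tendsto_const s_R] have "(\<lambda>n. u n s) \<longlonglongrightarrow> 1" by (simp add: u_def)
    then have F: "(\<lambda>n. flat_exp m (u n s)) \<longlonglongrightarrow> flat_exp m 1" for m
      by (rule isCont_tendsto_compose[OF DERIV_isCont[OF has_real_derivative_flat_exp]])
    show "(\<lambda>n. h1 n s) \<longlonglongrightarrow> flat_exp 2 1"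
      unfolding h1_def by (rule F)
    have "(\<lambda>n. - (flat_exp 4 (u n s) - 2 * flat_exp 3 (u n s)) * (1 / (R n)\<^sup>2))
      \<longlonglongrightarrow> - (flat_exp 4 1 - 2 * flat_exp 3 1) * 0"
      by (intro tendsto_intros F s_R)
    then show "(\<lambda>n. h2 n s) \<longlonglongrightarrow> 0"
      by (simp add: h2_def)
    show "0 < flat_exp 2 1" "0 < flat_exp 2 1 + 2 * s * 0" by (simp_all add: flat_exp_def)
  qed
qed

section \<open>Conclusion by cases\<close>

theorem theorem1p1:
  fixes p :: "real \<times> real \<Rightarrow> real"
    and mu lam :: real
    and f v :: "real^'n \<Rightarrow> real^'n"
    and \<rho> S :: "real^'n \<Rightarrow> real"
  assumes "pressure_law p"
    and "L1_loc f" and "weakly_divergence_free f"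
    and "(mu = 0 \<and> lam = 0) \<or> mu > 0"
    and "stationary_weak_solution p mu lam f \<rho> v S"
    and inviscid: "mu = 0 \<and> lam = 0 \<Longrightarrow>
      integrable lebesgue (\<lambda>x. (\<rho> x * (norm (v x))\<^sup>2 + p (\<rho> x, S x)) / (1 + norm x))"
    and viscous_a: "mu > 0 \<and> 2 * mu + lam = 0 \<Longrightarrow>
      integrable lebesgue (\<lambda>x. \<rho> x * (norm (v x))\<^sup>2 + p (\<rho> x, S x))"
    and viscous_b: "mu > 0 \<and> 2 * mu + lam \<noteq> 0 \<Longrightarrow> CARD('n) \<ge> 2 \<and>
      integrable lebesgue (\<lambda>x. \<rho> x * (norm (v x))\<^sup>2
        + norm (v x) powr (real CARD('n) / (real CARD('n) - 1)) + p (\<rho> x, S x))"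
  shows "AE x in lebesgue. \<rho> x = 0"
proof -
  note [measurable] = stationary_weak_solution_measurable(1-3)[OF assms(5)]
  let ?E = "\<lambda>x. \<rho> x * (norm (v x))\<^sup>2 + p (\<rho> x, S x)"
  have nonneg: "AE x in lebesgue. 0 \<le> ?E x"
    using stationary_weak_solution_measurable(4)[OF assms(5)]
      stationary_weak_solution_pressure_nonneg[OF assms(1,5)]
    by eventually_elim simp
  have [measurable]: "(\<lambda>x::real^'n. norm x) \<in> borel_measurable lebesgue"
    by (intro measurable_completion) simp
  have "AE x in lebesgue. p (\<rho> x, S x) = 0"
  \<comment> \<open>The split follows the coefficient of the viscous term. The inviscid case and
    viscous case (a) go together, since the integrability in (a) implies the weighted one.\<close>
  proof (cases "2 * mu + lam = 0")
    case True
    have "integrable lebesgue (\<lambda>x. ?E x / (1 + norm x))"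
    proof (cases "mu > 0")
      case pos: True
      with True viscous_a have "integrable lebesgue ?E" by simp
      then show ?thesis
      proof (rule Bochner_Integration.integrable_bound)
        have "\<bar>a\<bar> / \<bar>1 + norm x\<bar> \<le> \<bar>a\<bar>" for a and x :: "real^'n"
          by (simp add: divide_le_eq mult_le_cancel_left1 add_pos_nonneg)
        then show "AE x in lebesgue. norm (?E x / (1 + norm x)) \<le> norm (?E x)"
          by simp
      qed measurable
    next
      case False
      with assms(4) inviscid show ?thesis by simp
    qed
    with True show ?thesis
      by (intro pressure_vanishes_trace_free[OF assms(1,3,5)])
  next
    case False
    define r where "r = real CARD('n) / (real CARD('n) - 1)"
    from False assms(4) have "mu > 0" by auto
    with False viscous_b have N: "CARD('n) \<ge> 2"
      and int: "integrable lebesgue (\<lambda>x. \<rho> x * (norm (v x))\<^sup>2 + norm (v x) powr r + p (\<rho> x, S x))"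
      by (auto simp: r_def)
    \<comment> \<open>Integrability of the sum passes to its parts because they are nonnegative
      almost everywhere.\<close>
    have "integrable lebesgue ?E"
    proof (rule Bochner_Integration.integrable_bound[OF int])
      show "AE x in lebesgue. norm (?E x)
          \<le> norm (\<rho> x * (norm (v x))\<^sup>2 + norm (v x) powr r + p (\<rho> x, S x))"
        using nonneg
      proof eventually_elim
        case (elim x)
        then show ?case
          using powr_ge_zero[of "norm (v x)" r] unfolding real_norm_def by linarith
      qed
    qed measurable
    moreover have "integrable lebesgue (\<lambda>x. norm (v x) powr r)"
    proof (rule Bochner_Integration.integrable_bound[OF int])
      show "AE x in lebesgue. norm (norm (v x) powr r)
          \<le> norm (\<rho> x * (norm (v x))\<^sup>2 + norm (v x) powr r + p (\<rho> x, S x))"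
        using nonneg
      proof eventually_elim
        case (elim x)
        then show ?case
          using powr_ge_zero[of "norm (v x)" r] unfolding real_norm_def by linarith
      qed
    qed measurable
    ultimately show ?thesis
      using N unfolding r_def by (intro pressure_vanishes_viscous[OF assms(1,3,5)])
  qed
  \<comment> \<open>Zero pressure means zero density only at nonnegative densities, hence the sign
    of \<open>\<rho>\<close> is brought in.\<close>
  with stationary_weak_solution_measurable(4)[OF assms(5)] show ?thesis
  proof eventually_elim
    case (elim x)
    with assms(1) show ?case unfolding pressure_law_def by blast
  qed
qed

end
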